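(* Let $G$ be a connected, finite graph with the 4-cycle wheel property. Then $G$ is either a generalised discrete torus graph or a discrete Klein bottle graph.
   Context: $\mathbb{L}^2$ is the graph on $\mathbb{Z}^2$ with edges between points at Euclidean distance 1; automorphisms of $\mathbb{L}^2$ are regarded as isometries of $\mathbb{R}^2$. A graph $G$ has the 4-cycle wheel property if it is 4-regular and there is a family $\mathcal{C}$ of 4-cycles such that every vertex $v$ lies in exactly four cycles of $\mathcal{C}$ whose union is isomorphic to the subgraph of $\mathbb{L}^2$ induced by $\{-1,0,1\}^2$ (with $v$ the centre). For $\Gamma\le\mathrm{Aut}(\mathbb{L}^2)$, $\mathbb{L}^2/\Gamma$ is the quotient graph whose vertices are $\Gamma$-orbits of $\mathbb{Z}^2$ and whose edges are $\Gamma$-orbits of edges. A generalised discrete torus graph is a graph isomorphic to $\mathbb{L}^2/\Gamma$ where $\Gamma$ is generated by two translations $x\mapsto x+v_1$, $x\mapsto x+v_2$ with $v_1,v_2\in\mathbb{Z}^2$ linearly independent. A discrete Klein bottle graph is a graph isomorphic to $\mathbb{L}^2/\Gamma$ where $\Gamma=\langle g,t\rangle\le\mathrm{Aut}(\mathbb{L}^2)$, $g$ is a glide reflection (a translation followed by a reflection in an axis parallel to the translation direction) whose reflection axis is parallel to one of the lines $x=0$, $y=0$, $x=y$, $x+y=0$, and $t$ is an integer translation in a direction perpendicular to the reflection axis of $g$. *)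

theory Defs
  imports "HOL-Analysis.Analysis" "HOL-Algebra.Bij" "HOL-Algebra.Generated_Groups"
    "HOL-Algebra.Group_Action"
begin

section \<open>Graphs\<close>

text \<open>Orbit quotients of graphs may a priori have loops and parallel edges, so the common type
  of graphs has abstract edges, each with a set of one or two ends. In a simple graph the edges
  are the two-element sets of their ends.\<close>

record ('v, 'e) graph =
  verts :: "'v set"
  edges :: "'e set"
  ends :: "'e \<Rightarrow> 'v set"

definition simple_graph :: "('v, 'v set) graph \<Rightarrow> bool" where
  "simple_graph G \<longleftrightarrow> ends G = id \<and> (\<forall>e\<in>edges G. e \<subseteq> verts G \<and> card e = 2)"

definition graph_iso ::
  "('v, 'e) graph \<Rightarrow> ('w, 'f) graph \<Rightarrow> ('v \<Rightarrow> 'w) \<Rightarrow> ('e \<Rightarrow> 'f) \<Rightarrow> bool" where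
  "graph_iso G H \<phi> \<psi> \<longleftrightarrow>
     bij_betw \<phi> (verts G) (verts H) \<and> bij_betw \<psi> (edges G) (edges H) \<and>
     (\<forall>e\<in>edges G. ends H (\<psi> e) = \<phi> ` ends G e)"

definition isomorphic :: "('v, 'e) graph \<Rightarrow> ('w, 'f) graph \<Rightarrow> bool" where
  "isomorphic G H \<longleftrightarrow> (\<exists>\<phi> \<psi>. graph_iso G H \<phi> \<psi>)"

definition induced_subgraph :: "('v, 'e) graph \<Rightarrow> 'v set \<Rightarrow> ('v, 'e) graph" where
  "induced_subgraph G S =
     \<lparr>verts = verts G \<inter> S, edges = {e \<in> edges G. ends G e \<subseteq> S}, ends = ends G\<rparr>"

definition connected_graph :: "('v, 'e) graph \<Rightarrow> bool" where
  "connected_graph G \<longleftrightarrow> verts G \<noteq> {} \<and>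
     (\<forall>u\<in>verts G. \<forall>v\<in>verts G. (u, v) \<in> {(x, y). \<exists>e\<in>edges G. ends G e = {x, y}}\<^sup>*)"

definition finite_graph :: "('v, 'e) graph \<Rightarrow> bool" where
  "finite_graph G \<longleftrightarrow> finite (verts G) \<and> finite (edges G)"


section \<open>The square grid\<close>

definition to_plane :: "int \<times> int \<Rightarrow> real \<times> real" where
  "to_plane p = (real_of_int (fst p), real_of_int (snd p))"

definition grid :: "(int \<times> int, (int \<times> int) set) graph" where
  "grid = \<lparr>verts = UNIV,
           edges = {{p, q} |p q. dist (to_plane p) (to_plane q) = 1},
           ends = id\<rparr>"


section \<open>The 4-cycle wheel property\<close>

text \<open>In a simple graph a 4-cycle is given by its edge set; its vertex set is the union of its
  edges.\<close>

definition four_cycle :: "('v, 'v set) graph \<Rightarrow> 'v set set \<Rightarrow> bool" where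
  "four_cycle G C \<longleftrightarrow> C \<subseteq> edges G \<and>
     (\<exists>a b c d. distinct [a, b, c, d] \<and> C = {{a, b}, {b, c}, {c, d}, {d, a}})"

definition union_of_cycles :: "'v set set set \<Rightarrow> ('v, 'v set) graph" where
  "union_of_cycles \<C> = \<lparr>verts = \<Union>(\<Union>\<C>), edges = \<Union>\<C>, ends = id\<rparr>"

definition four_cycle_wheel_property :: "('v, 'v set) graph \<Rightarrow> bool" where
  "four_cycle_wheel_property G \<longleftrightarrow>
     (\<forall>v\<in>verts G. card {e \<in> edges G. v \<in> e} = 4) \<and>
     (\<exists>\<C>. (\<forall>C\<in>\<C>. four_cycle G C) \<and>
        (\<forall>v\<in>verts G. card {C \<in> \<C>. v \<in> \<Union>C} = 4 \<and>
           (\<exists>\<phi> \<psi>. graph_iso (union_of_cycles {C \<in> \<C>. v \<in> \<Union>C})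
                      (induced_subgraph grid ({-1, 0, 1} \<times> {-1, 0, 1})) \<phi> \<psi> \<and>
                  \<phi> v = (0, 0))))"


section \<open>Quotients of the grid\<close>

definition grid_Aut :: "(int \<times> int \<Rightarrow> int \<times> int) monoid" where
  "grid_Aut = (BijGroup UNIV)
     \<lparr>carrier := {f \<in> Bij UNIV. \<forall>e. f ` e \<in> edges grid \<longleftrightarrow> e \<in> edges grid}\<rparr>"

lemma group_grid_Aut: "group grid_Aut"
proof -
  have "subgroup {f \<in> Bij UNIV. \<forall>e. f ` e \<in> edges grid \<longleftrightarrow> e \<in> edges grid} (BijGroup UNIV)"
    (is "subgroup ?A _")
  proof (rule group.subgroupI[OF group_BijGroup])
    show "?A \<subseteq> carrier (BijGroup UNIV)"
      by (auto simp: BijGroup_def)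
    have "(\<lambda>x\<in>UNIV. x) \<in> ?A"
      by (auto simp: Bij_def bij_def)
    then show "?A \<noteq> {}" by blast
  next
    fix f assume f: "f \<in> ?A"
    then have bij: "bij f" by (simp add: Bij_def)
    have "inv\<^bsub>BijGroup UNIV\<^esub> f = restrict (inv_into UNIV f) UNIV"
      using f by (intro inv_BijGroup) auto
    then have eq: "inv\<^bsub>BijGroup UNIV\<^esub> f = inv_into UNIV f"
      by (simp add: restrict_def)
    have "inv_into UNIV f ` e \<in> edges grid \<longleftrightarrow> e \<in> edges grid" for e
    proof -
      have "f ` inv_into UNIV f ` e = e"
        using bij by (simp add: bij_is_surj image_f_inv_f)
      then show ?thesis using f by (metis (mono_tags, lifting) mem_Collect_eq)
    qed
    moreover have "inv_into UNIV f \<in> Bij UNIV"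
      using bij by (simp add: Bij_def bij_imp_bij_inv)
    ultimately show "inv\<^bsub>BijGroup UNIV\<^esub> f \<in> ?A"
      by (simp add: eq)
  next
    fix f g assume fg: "f \<in> ?A" "g \<in> ?A"
    then have "f \<otimes>\<^bsub>BijGroup UNIV\<^esub> g = f \<circ> g"
      by (simp add: BijGroup_def compose_def restrict_def comp_def)
    moreover have "f \<circ> g \<in> Bij UNIV"
      using fg by (simp add: Bij_def bij_comp)
    ultimately show "f \<otimes>\<^bsub>BijGroup UNIV\<^esub> g \<in> ?A"
      using fg by (simp del: comp_apply add: image_comp [symmetric])
  qed
  then show ?thesis
    unfolding grid_Aut_def by (rule group.subgroup_imp_group[OF group_BijGroup])
qed

definition translation :: "int \<times> int \<Rightarrow> int \<times> int \<Rightarrow> int \<times> int" where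
  "translation v = (\<lambda>x. x + v)"

lemma translation_in_grid_Aut: "translation v \<in> carrier grid_Aut"
proof -
  have fwd: "translation w ` e \<in> edges grid" if "e \<in> edges grid" for w e
  proof -
    from that obtain p q where pq: "e = {p, q}" "dist (to_plane p) (to_plane q) = 1"
      by (auto simp: grid_def)
    have "to_plane (x + w) = to_plane x + to_plane w" for x
      by (simp add: to_plane_def)
    with pq have "translation w ` e = {p + w, q + w}"
        "dist (to_plane (p + w)) (to_plane (q + w)) = 1"
      by (auto simp: translation_def)
    then show ?thesis unfolding grid_def graph.simps mem_Collect_eq by blast
  qed
  have "translation (- v) ` translation v ` e = e" for e
    by (simp add: translation_def image_image)
  with fwd have "translation v ` e \<in> edges grid \<longleftrightarrow> e \<in> edges grid" for e
    by metis
  moreover have "bij (translation v)"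
    unfolding translation_def by (rule bij_plus_right)
  ultimately show ?thesis
    by (simp add: grid_Aut_def Bij_def)
qed

abbreviation vertex_orbit ::
  "(int \<times> int \<Rightarrow> int \<times> int) monoid \<Rightarrow> int \<times> int \<Rightarrow> (int \<times> int) set" where
  "vertex_orbit \<Gamma> \<equiv> orbit \<Gamma> (\<lambda>f. f)"

text \<open>The ends of an orbit of edges are the orbits of the ends of its members; by equivariance
  these are already the orbits of the two ends of any single member.\<close>

definition grid_quotient ::
  "(int \<times> int \<Rightarrow> int \<times> int) set \<Rightarrow> ((int \<times> int) set, (int \<times> int) set set) graph" where
  "grid_quotient H = (let \<Gamma> = grid_Aut\<lparr>carrier := H\<rparr> in
     \<lparr>verts = orbits \<Gamma> (verts grid) (\<lambda>f. f),
      edges = orbits \<Gamma> (edges grid) (\<lambda>f. (`) f),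
      ends = (\<lambda>A. vertex_orbit \<Gamma> ` \<Union>A)\<rparr>)"


section \<open>Tori and Klein bottles\<close>

definition generalised_discrete_torus_graph :: "('v, 'e) graph \<Rightarrow> bool" where
  "generalised_discrete_torus_graph G \<longleftrightarrow>
     (\<exists>v\<^sub>1 v\<^sub>2. v\<^sub>1 \<noteq> v\<^sub>2 \<and> independent {to_plane v\<^sub>1, to_plane v\<^sub>2} \<and>
        isomorphic G (grid_quotient (generate grid_Aut {translation v\<^sub>1, translation v\<^sub>2})))"

text \<open>Reflection of the Euclidean plane in the line through \<open>a\<close> with direction \<open>u \<noteq> 0\<close>:
  the foot of the perpendicular from \<open>x\<close> is the midpoint of \<open>x\<close> and its image.\<close>

definition reflection_in_line :: "real \<times> real \<Rightarrow> real \<times> real \<Rightarrow> real \<times> real \<Rightarrow> real \<times> real" where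
  "reflection_in_line a u x = 2 *\<^sub>R (a + (((x - a) \<bullet> u) / (u \<bullet> u)) *\<^sub>R u) - x"

text \<open>A translation by a nonzero multiple of \<open>u\<close> followed by a reflection in a line with
  direction \<open>u\<close>. The line need not pass through a lattice point and the translation vector
  need not be integral, even if the glide reflection preserves the grid.\<close>

definition glide_reflection_along ::
  "real \<times> real \<Rightarrow> (real \<times> real \<Rightarrow> real \<times> real) \<Rightarrow> bool" where
  "glide_reflection_along u F \<longleftrightarrow> u \<noteq> 0 \<and>
     (\<exists>a c. c \<noteq> 0 \<and> F = (\<lambda>x. reflection_in_line a u (x + c *\<^sub>R u)))"

text \<open>The directions are those of the lines \<open>x = 0\<close>, \<open>y = 0\<close>, \<open>x = y\<close>, \<open>x + y = 0\<close>, in this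
  order; \<open>F\<close> is the isometry of the plane extending \<open>g\<close>.\<close>

definition discrete_Klein_bottle_graph :: "('v, 'e) graph \<Rightarrow> bool" where
  "discrete_Klein_bottle_graph G \<longleftrightarrow>
     (\<exists>u \<in> {(0, 1), (1, 0), (1, 1), (1, -1)}. \<exists>g \<in> carrier grid_Aut. \<exists>F w.
        glide_reflection_along u F \<and> (\<forall>p. F (to_plane p) = to_plane (g p)) \<and>
        w \<noteq> 0 \<and> to_plane w \<bullet> u = 0 \<and>
        isomorphic G (grid_quotient (generate grid_Aut {g, translation w})))"

end

theory Submission
  imports Defs
begin

text \<open>The wheel property gives a chart at every vertex, that is, a copy of the 3 by 3 block of the grid. Two
  charts at the same vertex differ by a symmetry of the square, and a chart determines the charts at
  its neighbours by agreement on the overlap. The resulting unit steps to the right and upwards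
  commute and permute the finite set of charts, so iterating them yields a covering of the graph by
  the grid. Its deck group acts transitively on the fibres, hence the graph is the quotient of the
  grid by the deck group. Injectivity of charts excludes nontrivial deck transformations
  that move a vertex within its 3 by 3 block, which rules out rotations and reflections. If only
  translations remain, the quotient is a torus. Otherwise all glide reflections have the same
  linear part and a common axis direction \<open>u\<close>; the group is generated by a glide
  reflection with minimal displacement along \<open>u\<close> and a translation perpendicular to \<open>u\<close>.\<close>

section \<open>Symmetries of the 3 by 3 block\<close>

text \<open>The obstacle is that small quotients look unlike the grid from afar. In the 4 by 4 torus
  each row is a 4-cycle that bounds no face, and in the 3 by 3 torus all blocks have the same
  vertices. Hence adjacent charts are compared only through the two squares of the family on the
  edge that joins their centres. Commuting steps take the place of simple connectivity: they make
  the end of a lattice walk independent of the order of its moves. Finiteness enters twice: it turns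
  the injective steps into bijections, so that walks can also run backwards, and by pigeonhole it
  gives deck transformations carrying one multiple of a given vector to another, so that the deck
  group has no direction without displacement. Injectivity on all nine points of a block, rather
  than on a centre and its neighbours, matters for the classification: a half turn about the centre
  of a square moves no lattice point by less than a diagonal step.\<close>

definition blk :: "(int \<times> int) set" where
  "blk = {-1, 0, 1} \<times> {-1, 0, 1}"

definition dirs :: "(int \<times> int) set" where
  "dirs = {(1, 0), (-1, 0), (0, 1), (0, -1)}"

definition diags :: "(int \<times> int) set" where
  "diags = {-1, 1} \<times> {-1, 1}"

text \<open>For \<open>s\<close> in \<open>diags\<close> this is the unit square with opposite
  corners the origin and \<open>s\<close>; the four of them cover the block.\<close>

definition sq :: "int \<times> int \<Rightarrow> (int \<times> int) set" where
  "sq s = {0, fst s} \<times> {0, snd s}"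

definition ip :: "int \<times> int \<Rightarrow> int \<times> int \<Rightarrow> int" where
  "ip p q = fst p * fst q + snd p * snd q"

definition lin :: "int \<times> int \<Rightarrow> int \<times> int \<Rightarrow> int \<times> int \<Rightarrow> int \<times> int" where
  "lin d e p = (fst p * fst d + snd p * fst e, fst p * snd d + snd p * snd e)"

text \<open>The dihedral group of the square, listed by the images of the two basis vectors.\<close>

definition syms :: "(int \<times> int \<Rightarrow> int \<times> int) set" where
  "syms = {lin d e |d e. d \<in> dirs \<and> e \<in> dirs \<and> ip d e = 0}"

lemma blk_iff: "p \<in> blk \<longleftrightarrow> \<bar>fst p\<bar> \<le> 1 \<and> \<bar>snd p\<bar> \<le> 1"
proof -
  have "a \<in> {-1, 0, 1} \<longleftrightarrow> \<bar>a\<bar> \<le> 1" for a :: int by auto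
  then show ?thesis by (simp only: blk_def mem_Times_iff)
qed

lemma blk_eq:
  "blk = {(0, 0), (1, 0), (-1, 0), (0, 1), (0, -1), (1, 1), (1, -1), (-1, 1), (-1, -1)}"
  unfolding blk_def by (simp add: insert_Times_insert) blast

lemma diags_iff: "p \<in> diags \<longleftrightarrow> \<bar>fst p\<bar> = 1 \<and> \<bar>snd p\<bar> = 1"
proof -
  have "a \<in> {-1, 1} \<longleftrightarrow> \<bar>a\<bar> = 1" for a :: int by auto
  then show ?thesis by (simp only: diags_def mem_Times_iff)
qed

lemma symsE:
  assumes "\<sigma> \<in> syms"
  obtains d e where "\<sigma> = lin d e" "d \<in> dirs" "e \<in> dirs" "ip d e = 0"
  using assms by (auto simp: syms_def)

lemma lin_in_syms: "d \<in> dirs \<Longrightarrow> e \<in> dirs \<Longrightarrow> ip d e = 0 \<Longrightarrow> lin d e \<in> syms"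
  unfolding syms_def by blast

text \<open>The eight frames reduce later claims about \<open>syms\<close> and perpendicular
  directions to a finite check.\<close>

lemma perp_cases [consumes 3]:
  assumes "d \<in> dirs" "e \<in> dirs" "ip d e = 0"
  obtains "d = (1, 0)" "e = (0, 1)" | "d = (1, 0)" "e = (0, -1)"
    | "d = (-1, 0)" "e = (0, 1)" | "d = (-1, 0)" "e = (0, -1)"
    | "d = (0, 1)" "e = (1, 0)" | "d = (0, 1)" "e = (-1, 0)"
    | "d = (0, -1)" "e = (1, 0)" | "d = (0, -1)" "e = (-1, 0)"
  using assms by (auto simp: dirs_def ip_def)

lemma syms_add: "\<sigma> \<in> syms \<Longrightarrow> \<sigma> (p + q) = \<sigma> p + \<sigma> q"
  by (auto simp: syms_def lin_def algebra_simps)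

lemma syms_diff: "\<sigma> \<in> syms \<Longrightarrow> \<sigma> (p - q) = \<sigma> p - \<sigma> q"
  by (auto simp: syms_def lin_def algebra_simps)

lemma syms_zero: "\<sigma> \<in> syms \<Longrightarrow> \<sigma> (0, 0) = (0, 0)"
  by (auto simp: syms_def lin_def)

lemma lin_basis [simp]: "lin d e (1, 0) = d" "lin d e (0, 1) = e"
  by (auto simp: lin_def)

lemma lin_id: "lin (1, 0) (0, 1) = id"
  by (auto simp: lin_def)

lemma id_in_syms: "id \<in> syms"
  unfolding lin_id[symmetric] by (rule lin_in_syms) (auto simp: dirs_def ip_def)

lemma lin_comp: "lin d e \<circ> lin d' e' = lin (lin d e d') (lin d e e')"
  by (auto simp: lin_def algebra_simps)

lemma syms_dirs: "\<sigma> \<in> syms \<Longrightarrow> d \<in> dirs \<Longrightarrow> \<sigma> d \<in> dirs"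
  by (auto simp: syms_def dirs_def lin_def ip_def)

lemma syms_ip: "\<sigma> \<in> syms \<Longrightarrow> ip (\<sigma> p) (\<sigma> q) = ip p q"
  by (auto simp: syms_def dirs_def lin_def ip_def)

lemma syms_comp:
  assumes "\<sigma> \<in> syms" "\<tau> \<in> syms"
  shows "\<sigma> \<circ> \<tau> \<in> syms"
  using assms(2)
proof (rule symsE)
  fix d e assume de: "\<tau> = lin d e" "d \<in> dirs" "e \<in> dirs" "ip d e = 0"
  have "\<sigma> \<circ> \<tau> = lin (\<sigma> d) (\<sigma> e)"
    using assms(1) de(1) by (auto elim!: symsE simp: lin_comp)
  then show ?thesis
    using lin_in_syms syms_dirs[OF assms(1)] syms_ip[OF assms(1)] de by metis
qed

lemma syms_inverse:
  assumes "\<sigma> \<in> syms"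
  obtains \<tau> where "\<tau> \<in> syms" "\<And>p. \<sigma> (\<tau> p) = p" "\<And>p. \<tau> (\<sigma> p) = p"
  using assms
proof (rule symsE)
  fix d e assume de: "\<sigma> = lin d e" "d \<in> dirs" "e \<in> dirs" "ip d e = 0"
  \<comment> \<open>The matrix with columns \<open>d\<close> and \<open>e\<close> is orthogonal, so
    its transpose is its inverse.\<close>
  let ?t = "lin (fst d, fst e) (snd d, snd e)"
  show thesis
  proof (rule that[of ?t])
    show "?t \<in> syms"
      using de(2-4) by (intro lin_in_syms; cases rule: perp_cases) (simp_all add: dirs_def ip_def)
  qed (use de(2-4) in \<open>cases rule: perp_cases; simp add: de(1) lin_def\<close>)+
qed

lemma syms_blk:
  assumes "\<sigma> \<in> syms" "p \<in> blk"
  shows "\<sigma> p \<in> blk"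
  using assms(1)
proof (rule symsE)
  fix d e assume "\<sigma> = lin d e" "d \<in> dirs" "e \<in> dirs" "ip d e = 0"
  from this(2-4,1) assms(2) show ?thesis
    by (cases rule: perp_cases) (simp_all add: blk_iff lin_def)
qed

lemma syms_image_eq:
  assumes "\<sigma> \<in> syms" "\<And>\<tau> p. \<tau> \<in> syms \<Longrightarrow> p \<in> S \<Longrightarrow> \<tau> p \<in> S"
  shows "\<sigma> ` S = S"
proof -
  obtain \<tau> where t: "\<tau> \<in> syms" "\<And>p. \<sigma> (\<tau> p) = p" using syms_inverse[OF assms(1)] by metis
  have "p \<in> \<sigma> ` S" if "p \<in> S" for p
    using t assms(2)[OF t(1) that] by (metis imageI)
  then show ?thesis using assms by auto
qed

lemma syms_diags:
  assumes "\<sigma> \<in> syms" "p \<in> diags"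
  shows "\<sigma> p \<in> diags"
  using assms(1)
proof (rule symsE)
  fix d e assume "\<sigma> = lin d e" "d \<in> dirs" "e \<in> dirs" "ip d e = 0"
  from this(2-4,1) assms(2) show ?thesis
    by (cases rule: perp_cases) (simp_all add: diags_iff lin_def)
qed

lemma sq_eq: "sq s = {(0, 0), (fst s, 0), (0, snd s), s}"
  by (auto simp: sq_def prod_eq_iff)

lemma syms_sq:
  assumes "\<sigma> \<in> syms"
  shows "\<sigma> ` sq s = sq (\<sigma> s)"
  using assms
proof (rule symsE)
  fix d e assume "\<sigma> = lin d e" "d \<in> dirs" "e \<in> dirs" "ip d e = 0"
  from this(2-4,1) show ?thesis
    by (cases rule: perp_cases) (simp_all add: sq_eq lin_def insert_commute)
qed

lemma inj_syms: "\<sigma> \<in> syms \<Longrightarrow> inj \<sigma>"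
  by (metis injI syms_inverse)

section \<open>Recognising symmetries by the squares at the origin\<close>

lemma sq_diags: "s \<in> diags \<Longrightarrow> sq s \<subseteq> blk"
  by (auto simp: sq_eq diags_iff blk_iff)

lemma dirs_blk: "dirs \<subseteq> blk"
  by (auto simp: dirs_def blk_iff)

lemma dirs_sum_diags: "d \<in> dirs \<Longrightarrow> e \<in> dirs \<Longrightarrow> ip d e = 0 \<Longrightarrow> d + e \<in> diags"
  by (cases rule: perp_cases) (auto simp: diags_iff)

lemma dirs_sum_blk: "d \<in> dirs \<Longrightarrow> e \<in> dirs \<Longrightarrow> ip d e = 0 \<Longrightarrow> d + e \<in> blk"
  by (cases rule: perp_cases) (auto simp: blk_iff)

lemma sq_dirs_sum: "d \<in> dirs \<Longrightarrow> e \<in> dirs \<Longrightarrow> ip d e = 0 \<Longrightarrow> sq (d + e) = {(0, 0), d, e, d + e}"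
  by (cases rule: perp_cases) (auto simp: sq_eq)

lemma sq_dirs: "s \<in> diags \<Longrightarrow> (fst s, 0) \<in> dirs \<and> (0, snd s) \<in> dirs"
  by (auto simp: diags_iff dirs_def)

text \<open>Two squares at the origin coincide, share an edge or share only the origin. Only an edge
  gives an intersection of two points, so directions can be recognised from incidences of
  squares.\<close>

lemma sq_Int_dir:
  assumes "s \<in> diags" "t \<in> diags" "sq s \<inter> sq t = {(0, 0), x}" "x \<noteq> (0, 0)"
  shows "x \<in> dirs"
proof (rule ccontr)
  assume "x \<notin> dirs"
  have "x \<in> sq s" "x \<in> sq t" using assms(3) by auto
  then have "s = x" "t = x"
    using \<open>x \<notin> dirs\<close> assms(4) sq_dirs[OF assms(1)] sq_dirs[OF assms(2)] by (auto simp: sq_eq)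
  then have "(fst x, 0) = (0, 0) \<or> (fst x, 0) = x"
    using assms(3) by (auto simp: sq_eq)
  then show False
    using assms(1) \<open>s = x\<close> by (cases x) (auto simp: diags_iff)
qed

text \<open>Only two corners of a square at the origin are directions, so the third nonzero corner
  is the opposite one.\<close>

lemma sq_corner:
  assumes "x \<noteq> y" "z \<noteq> x" "z \<noteq> y" "z \<noteq> (0, 0)" "x \<in> sq t" "y \<in> sq t" "z \<in> sq t"
    and "x \<in> dirs" "y \<in> dirs" "t \<in> diags"
  shows "z = x + y \<and> ip x y = 0"
proof -
  obtain a b where t: "t = (a, b)" by fastforce
  have "(0, 0) \<notin> dirs" "(a, b) \<notin> dirs"
    using assms(10) by (auto simp: t dirs_def diags_iff)
  then have "x \<in> {(a, 0), (0, b)}" "y \<in> {(a, 0), (0, b)}" "z \<in> {(a, 0), (0, b), (a, b)}"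
    using assms(4-9) by (auto simp: t sq_eq)
  then show ?thesis
    using assms(1-4) by (auto simp: ip_def)
qed

lemma dirs_opposite:
  assumes "x \<in> dirs" "x' \<in> dirs" "y \<in> dirs" "ip x y = 0" "ip x' y = 0" "x' \<noteq> x"
  shows "x' = - x"
  using assms by (auto simp: dirs_def ip_def)

text \<open>A direction is the second common point of two squares, so \<open>\<pi>\<close> maps
  directions to directions. In each square the remaining corner is the sum of the two directions,
  and opposite directions are the two perpendicular to a third. Thus the images of the two basis
  vectors determine \<open>\<pi>\<close> on the block.\<close>

lemma square_preserving_is_sym:
  assumes inj: "inj_on \<pi> blk"
    and sqs: "\<And>s. s \<in> diags \<Longrightarrow> \<exists>t\<in>diags. \<pi> ` sq s = sq t"
    and zero: "\<pi> (0, 0) = (0, 0)"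
  obtains \<sigma> where "\<sigma> \<in> syms" "\<And>p. p \<in> blk \<Longrightarrow> \<pi> p = \<sigma> p"
proof -
  have dir: "\<pi> d \<in> dirs" if "d \<in> dirs" for d
  proof -
    obtain s t where st: "s \<in> diags" "t \<in> diags" "sq s \<inter> sq t = {(0, 0), d}"
    proof -
      \<comment> \<open>Swapping the coordinates of a direction gives a perpendicular one; the
        squares on its two sides meet exactly in the edge from the origin to
        \<open>d\<close>.\<close>
      let ?e = "(snd d, fst d)"
      have "sq (d + ?e) \<inter> sq (d - ?e) = {(0, 0), d}" "d + ?e \<in> diags" "d - ?e \<in> diags"
        using \<open>d \<in> dirs\<close> unfolding dirs_def diags_iff sq_def Times_Int_Times
        by (elim insertE emptyE; simp)+
      then show thesis using that by blast
    qed
    obtain s' t' where st': "s' \<in> diags" "t' \<in> diags" "\<pi> ` sq s = sq s'" "\<pi> ` sq t = sq t'"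
      using sqs st by meson
    have "\<pi> ` (sq s \<inter> sq t) = \<pi> ` sq s \<inter> \<pi> ` sq t"
      by (rule inj_on_image_Int[OF inj]) (use st sq_diags in auto)
    then have eq: "sq s' \<inter> sq t' = {(0, 0), \<pi> d}"
      using st st' zero by simp
    have "\<pi> d \<noteq> (0, 0)"
      using inj_onD[OF inj, of d "(0, 0)"] \<open>d \<in> dirs\<close> zero by (auto simp: dirs_def blk_iff)
    with eq st' show ?thesis by (intro sq_Int_dir)
  qed
  have corner: "\<pi> (d + e) = \<pi> d + \<pi> e \<and> ip (\<pi> d) (\<pi> e) = 0"
    if de: "d \<in> dirs" "e \<in> dirs" "ip d e = 0" for d e
  proof -
    obtain t where t: "t \<in> diags" "\<pi> ` sq (d + e) = sq t"
      using sqs dirs_sum_diags[OF de] by meson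
    have eq: "{(0, 0), \<pi> d, \<pi> e, \<pi> (d + e)} = sq t"
      using t(2) zero by (simp add: sq_dirs_sum[OF de])
    have "d \<noteq> e \<and> d + e \<noteq> d \<and> d + e \<noteq> e \<and> d + e \<noteq> (0, 0)"
      using de by (cases rule: perp_cases) simp_all
    moreover have "d \<in> blk" "e \<in> blk" "d + e \<in> blk" "(0, 0) \<in> blk"
      using de dirs_blk dirs_sum_blk[OF de] by (blast, blast, blast, simp add: blk_iff)
    ultimately have ne: "\<pi> d \<noteq> \<pi> e" "\<pi> (d + e) \<noteq> \<pi> d" "\<pi> (d + e) \<noteq> \<pi> e" "\<pi> (d + e) \<noteq> (0, 0)"
      using inj_on_eq_iff[OF inj, of d e] inj_on_eq_iff[OF inj, of "d + e" d]
        inj_on_eq_iff[OF inj, of "d + e" e] inj_on_eq_iff[OF inj, of "d + e" "(0, 0)"]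
      by (simp_all add: zero)
    have "\<pi> d \<in> sq t" "\<pi> e \<in> sq t" "\<pi> (d + e) \<in> sq t" using eq by blast+
    then show ?thesis
      by (intro sq_corner[OF ne]) (use dir de t in blast)+
  qed
  define \<sigma> where "\<sigma> = lin (\<pi> (1, 0)) (\<pi> (0, 1))"
  have d0: "(1, 0) \<in> dirs" "(-1, 0) \<in> dirs" "(0, 1) \<in> dirs" "(0, -1) \<in> dirs"
    by (auto simp: dirs_def)
  have s: "\<sigma> \<in> syms"
    unfolding \<sigma>_def using corner[of "(1,0)" "(0,1)"] d0 dir by (intro lin_in_syms) (auto simp: ip_def)
  have neg: "\<pi> (-1, 0) = - \<pi> (1, 0)" "\<pi> (0, -1) = - \<pi> (0, 1)"
  proof -
    have "\<pi> (-1, 0) \<noteq> \<pi> (1, 0)" "\<pi> (0, -1) \<noteq> \<pi> (0, 1)"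
      using inj_onD[OF inj, of "(-1, 0)" "(1, 0)"] inj_onD[OF inj, of "(0, -1)" "(0, 1)"]
      by (auto simp: blk_iff)
    moreover have "ip (\<pi> (1, 0)) (\<pi> (0, 1)) = 0" "ip (\<pi> (-1, 0)) (\<pi> (0, 1)) = 0"
        "ip (\<pi> (0, 1)) (\<pi> (1, 0)) = 0" "ip (\<pi> (0, -1)) (\<pi> (1, 0)) = 0"
      by (intro corner[THEN conjunct2] d0; simp add: ip_def)+
    ultimately show "\<pi> (-1, 0) = - \<pi> (1, 0)" "\<pi> (0, -1) = - \<pi> (0, 1)"
      using dirs_opposite dir d0 by meson+
  qed
  have "\<pi> p = \<sigma> p" if p: "p \<in> blk" for p
  proof -
    have *: "\<sigma> (1, 0) = \<pi> (1, 0)" "\<sigma> (0, 1) = \<pi> (0, 1)" "\<sigma> (-1, 0) = \<pi> (-1, 0)" "\<sigma> (0, -1) = \<pi> (0, -1)"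
      unfolding neg by (auto simp: \<sigma>_def lin_def prod_eq_iff)
    have **: "\<sigma> (d + e) = \<pi> (d + e)" if "d \<in> dirs" "e \<in> dirs" "ip d e = 0" "\<sigma> d = \<pi> d" "\<sigma> e = \<pi> e" for d e
      using corner that syms_add[OF s] by metis
    have "\<sigma> (1, 1) = \<pi> (1, 1)" "\<sigma> (1, -1) = \<pi> (1, -1)" "\<sigma> (-1, 1) = \<pi> (-1, 1)" "\<sigma> (-1, -1) = \<pi> (-1, -1)"
      using **[of "(1, 0)" "(0, 1)"] **[of "(1, 0)" "(0, -1)"] **[of "(-1, 0)" "(0, 1)"] **[of "(-1, 0)" "(0, -1)"] *
      by (simp_all add: d0 ip_def)
    moreover have "p \<in> {(0, 0), (1, 0), (-1, 0), (0, 1), (0, -1), (1, 1), (1, -1), (-1, 1), (-1, -1)}"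
      using p unfolding blk_eq .
    ultimately show ?thesis
      using * zero syms_zero[OF s] by (elim insertE emptyE) simp_all
  qed
  with s show thesis by (rule that)
qed

lemma ip_commute: "ip x y = ip y x"
  by (simp add: ip_def mult.commute)

lemma syms_neg: "\<sigma> \<in> syms \<Longrightarrow> \<sigma> (- p) = - \<sigma> p"
  by (auto simp: syms_def lin_def)

lemma perp_exists:
  assumes "d \<in> dirs"
  obtains e where "e \<in> dirs" "ip d e = 0"
proof
  show "(snd d, - fst d) \<in> dirs" "ip d (snd d, - fst d) = 0"
    using assms by (auto simp: dirs_def ip_def)
qed

lemma syms_transitive:
  assumes "d \<in> dirs" "e \<in> dirs" "ip d e = 0" "d' \<in> dirs" "e' \<in> dirs" "ip d' e' = 0"
  obtains \<sigma> where "\<sigma> \<in> syms" "\<sigma> d = d'" "\<sigma> e = e'"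
proof -
  obtain \<tau> where "\<tau> \<in> syms" "\<And>p. \<tau> (lin d e p) = p"
    using syms_inverse[OF lin_in_syms[OF assms(1-3)]] by metis
  then have "lin d' e' \<circ> \<tau> \<in> syms" "(lin d' e' \<circ> \<tau>) d = d'" "(lin d' e' \<circ> \<tau>) e = e'"
    using syms_comp[OF lin_in_syms[OF assms(4-6)]] by (auto, metis lin_basis, metis lin_basis)
  then show thesis by (rule that)
qed

text \<open>These six points are the overlap of two blocks with adjacent centres, written in a frame
  adapted to \<open>d\<close>.\<close>

lemma blk_shift_cases:
  assumes "d \<in> dirs" "e \<in> dirs" "ip d e = 0" "p \<in> blk" "p + d \<in> blk"
  shows "p \<in> {(0, 0), - d, e, - e, - d + e, - d + - e}"
  using assms(1-3,5) assms(4)[unfolded blk_eq]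
  by (cases rule: perp_cases) (elim insertE emptyE; simp add: blk_iff)+


section \<open>Charts\<close>

text \<open>A chart at \<open>v\<close> is a copy of the 3 by 3 block centred at \<open>v\<close>. Here \<open>N\<close> gives the neighbours in
  the graph, and \<open>\<S>\<close> holds only the vertex sets of the cycles in the given family; the adjacencies
  recorded in the last two conjuncts then fix how a square is traversed.\<close>
definition is_chart :: "'v set \<Rightarrow> ('v \<Rightarrow> 'v set) \<Rightarrow> 'v set set \<Rightarrow> (int \<times> int \<Rightarrow> 'v) \<Rightarrow> bool" where
  "is_chart V N \<S> c \<longleftrightarrow> c \<in> extensional blk \<and> inj_on c blk \<and> c ` blk \<subseteq> V \<and>
     {S \<in> \<S>. c (0, 0) \<in> S} = (\<lambda>s. c ` sq s) ` diags \<and> N (c (0, 0)) = c ` dirs \<and>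
     (\<forall>d\<in>dirs. c (0, 0) \<in> N (c d)) \<and>
     (\<forall>d\<in>dirs. \<forall>e\<in>dirs. ip d e = 0 \<longrightarrow> c (d + e) \<in> N (c d))"

locale wheel =
  fixes V :: "'v set" and N :: "'v \<Rightarrow> 'v set" and \<S> :: "'v set set"
  assumes finite_V: "finite V"
    and chart_exists: "v \<in> V \<Longrightarrow> \<exists>c. is_chart V N \<S> c \<and> c (0, 0) = v"
begin

abbreviation chart where "chart \<equiv> is_chart V N \<S>"

text \<open>Extensionality makes a chart nothing more than its nine values, which is also why there
  are only finitely many charts.\<close>

lemma chart_ext: "chart c \<Longrightarrow> chart c' \<Longrightarrow> (\<And>p. p \<in> blk \<Longrightarrow> c p = c' p) \<Longrightarrow> c = c'"
  unfolding is_chart_def by (elim conjE) (rule extensionalityI)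

lemma chart_inj: "chart c \<Longrightarrow> inj_on c blk"
  and chart_in_V: "chart c \<Longrightarrow> p \<in> blk \<Longrightarrow> c p \<in> V"
  and chart_squares: "chart c \<Longrightarrow> {S \<in> \<S>. c (0, 0) \<in> S} = (\<lambda>s. c ` sq s) ` diags"
  and chart_nbrs: "chart c \<Longrightarrow> N (c (0, 0)) = c ` dirs"
  and chart_centre: "chart c \<Longrightarrow> d \<in> dirs \<Longrightarrow> c (0, 0) \<in> N (c d)"
  and chart_corner: "chart c \<Longrightarrow> d \<in> dirs \<Longrightarrow> e \<in> dirs \<Longrightarrow> ip d e = 0 \<Longrightarrow> c (d + e) \<in> N (c d)"
  unfolding is_chart_def by (blast, blast, elim conjE, assumption, elim conjE, assumption, blast, blast)

lemma chart_eq_iff: "chart c \<Longrightarrow> p \<in> blk \<Longrightarrow> q \<in> blk \<Longrightarrow> c p = c q \<longleftrightarrow> p = q"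
  using chart_inj inj_on_eq_iff by metis

lemma zero_blk: "(0, 0) \<in> blk" by (simp add: blk_iff)

lemma chart_sym:
  assumes c: "chart c" and s: "\<sigma> \<in> syms"
  shows "chart (restrict (c \<circ> \<sigma>) blk)"
proof -
  have blk: "\<sigma> ` blk = blk" and dirs: "\<sigma> ` dirs = dirs" and diags: "\<sigma> ` diags = diags"
    using syms_image_eq[OF s] syms_blk syms_dirs syms_diags by blast+
  have sq: "restrict (c \<circ> \<sigma>) blk ` sq s = c ` sq (\<sigma> s)" if "s \<in> diags" for s
    using sq_diags[OF that] by (auto simp: syms_sq[OF s, symmetric])
  have "inj_on (c \<circ> \<sigma>) blk"
    using chart_inj[OF c] inj_syms[OF s] blk by (metis comp_inj_on inj_on_subset subset_UNIV)
  moreover have "(c \<circ> \<sigma>) ` blk \<subseteq> V"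
    using chart_in_V[OF c] syms_blk[OF s] by (simp add: image_subset_iff del: split_paired_All)
  moreover have "(\<lambda>t. restrict (c \<circ> \<sigma>) blk ` sq t) ` diags = (\<lambda>s. c ` sq s) ` \<sigma> ` diags"
    unfolding image_image using sq by (rule image_cong[OF refl])
  moreover have "restrict (c \<circ> \<sigma>) blk ` dirs = c ` \<sigma> ` dirs"
    unfolding image_image by (rule image_cong) (use dirs_blk in auto)
  moreover have "restrict (c \<circ> \<sigma>) blk (d + e) \<in> N (restrict (c \<circ> \<sigma>) blk d)"
    if "d \<in> dirs" "e \<in> dirs" "ip d e = 0" for d e
    using chart_corner[OF c, of "\<sigma> d" "\<sigma> e"] that s dirs_blk dirs_sum_blk[OF that]
    by (auto simp: syms_add syms_dirs syms_ip)
  moreover have "restrict (c \<circ> \<sigma>) blk (0, 0) \<in> N (restrict (c \<circ> \<sigma>) blk d)" if "d \<in> dirs" for d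
    using chart_centre[OF c syms_dirs[OF s that]] zero_blk dirs_blk that
    by (auto simp: syms_zero[OF s])
  ultimately show ?thesis
    using chart_squares[OF c] chart_nbrs[OF c] zero_blk
    unfolding is_chart_def by (simp add: syms_zero[OF s] dirs diags)
qed

text \<open>Both charts list the same squares, those of \<open>\<S>\<close> through the common
  centre. The transition map between them therefore fixes the origin and permutes the squares of the
  block.\<close>

lemma chart_unique:
  assumes c: "chart c" and c': "chart c'" and eq: "c (0, 0) = c' (0, 0)"
  obtains \<sigma> where "\<sigma> \<in> syms" "\<And>p. p \<in> blk \<Longrightarrow> c' p = c (\<sigma> p)"
proof -
  have sub: "c' ` blk \<subseteq> c ` blk"
  proof -
    have U: "blk = \<Union>(sq ` diags)" unfolding blk_eq diags_def sq_eq
      by auto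
    have "c ` blk = \<Union>((\<lambda>s. c ` sq s) ` diags)" for c :: "int \<times> int \<Rightarrow> 'v"
      unfolding U by blast
    then show ?thesis using chart_squares[OF c] chart_squares[OF c'] eq by simp
  qed
  define \<pi> where "\<pi> = inv_into blk c \<circ> c'"
  have c\<pi>: "c (\<pi> p) = c' p" "\<pi> p \<in> blk" if "p \<in> blk" for p
    using sub that by (auto simp: \<pi>_def f_inv_into_f image_subset_iff inv_into_into)
  have "inj_on \<pi> blk"
    by (rule inj_onI) (use c\<pi> chart_eq_iff[OF c'] in metis)
  moreover have "\<exists>t\<in>diags. \<pi> ` sq s = sq t" if s: "s \<in> diags" for s
  proof -
    have "c' ` sq s \<in> (\<lambda>s. c ` sq s) ` diags"
      using chart_squares[OF c] chart_squares[OF c'] eq s by auto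
    then obtain t where t: "t \<in> diags" "c' ` sq s = c ` sq t" by auto
    have "c ` (\<pi> ` sq s) = c ` sq t"
    proof -
      have "(\<lambda>x. c (\<pi> x)) ` sq s = c' ` sq s"
        by (rule image_cong) (use c\<pi>(1) sq_diags[OF s] in blast)+
      then show ?thesis using t(2) by (simp add: image_image)
    qed
    moreover have "\<pi> ` sq s \<subseteq> blk" using c\<pi>(2) sq_diags[OF s] by auto
    ultimately have "\<pi> ` sq s = sq t"
      by (simp add: inj_on_image_eq_iff[OF chart_inj[OF c]] sq_diags[OF t(1)])
    then show ?thesis using t(1) by blast
  qed
  moreover have "\<pi> (0, 0) = (0, 0)"
    using c\<pi>[OF zero_blk] chart_eq_iff[OF c _ zero_blk] eq by metis
  ultimately obtain \<sigma> where "\<sigma> \<in> syms" "\<And>p. p \<in> blk \<Longrightarrow> \<pi> p = \<sigma> p"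
    using square_preserving_is_sym by metis
  then show thesis using that c\<pi> by metis
qed

text \<open>A symmetry that fixes two perpendicular directions is the identity. All later
  comparisons of charts go through this criterion: a centre and two perpendicular neighbours are
  enough.\<close>

lemma chart_unique':
  assumes c: "chart c" and c': "chart c'"
    and eq: "c (0, 0) = c' (0, 0)" "c d = c' d" "c e = c' e"
    and de: "d \<in> dirs" "e \<in> dirs" "ip d e = 0"
  shows "c = c'"
proof -
  obtain \<sigma> where s: "\<sigma> \<in> syms" "\<And>p. p \<in> blk \<Longrightarrow> c' p = c (\<sigma> p)"
    using chart_unique[OF c c' eq(1)] by metis
  have fixed: "\<sigma> x = x" if "x \<in> blk" "c x = c' x" for x
    using s that chart_eq_iff[OF c] syms_blk by metis
  have fixed': "\<sigma> d = d" "\<sigma> e = e" using fixed eq de dirs_blk by blast+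
  obtain a b where ab: "\<sigma> = lin a b" using s(1) by (rule symsE)
  have "\<sigma> = lin (1, 0) (0, 1)"
    using de fixed' unfolding ab by (cases rule: perp_cases) (auto simp: lin_def prod_eq_iff)
  then show ?thesis
    by (intro chart_ext[OF c c']) (simp add: s(2) lin_id)
qed

section \<open>Recentring a chart at a neighbouring vertex\<close>

definition follows :: "int \<times> int \<Rightarrow> (int \<times> int \<Rightarrow> 'v) \<Rightarrow> (int \<times> int \<Rightarrow> 'v) \<Rightarrow> bool" where
  "follows d c c' \<longleftrightarrow> (\<forall>p\<in>blk. p + d \<in> blk \<longrightarrow> c' p = c (p + d))"

lemma followsD: "follows d c c' \<Longrightarrow> p \<in> blk \<Longrightarrow> p + d \<in> blk \<Longrightarrow> c' p = c (p + d)"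
  by (auto simp: follows_def)

text \<open>This reads one square on the edge between the two centres in the other chart. It
  contains the centre of \<open>c'\<close>, so it is a square of \<open>c'\<close> as well. The
  adjacency of \<open>c (d + e)\<close> to \<open>c d\<close> makes that vertex a direction
  \<open>\<epsilon>\<close> of \<open>c'\<close>, and \<open>c e\<close> is left for the corner
  opposite to the centre.\<close>

lemma neighbour_square:
  assumes c: "chart c" and c': "chart c'" and eq: "c' (0, 0) = c d" "c' \<delta> = c (0, 0)"
    and de: "d \<in> dirs" "e \<in> dirs" "ip d e = 0" and \<delta>: "\<delta> \<in> dirs"
  obtains \<epsilon> where "\<epsilon> \<in> dirs" "ip \<delta> \<epsilon> = 0" "c' \<epsilon> = c (d + e)" "c' (\<delta> + \<epsilon>) = c e"
proof -
  have blk: "d \<in> blk" "e \<in> blk" "d + e \<in> blk"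
    using de dirs_blk dirs_sum_blk[OF de] by auto
  have "c (d + e) \<in> c' ` dirs"
    using chart_corner[OF c de] chart_nbrs[OF c'] eq by simp
  then obtain \<epsilon> where \<epsilon>: "\<epsilon> \<in> dirs" "c' \<epsilon> = c (d + e)" by auto
  have "c ` sq (d + e) \<in> \<S>"
    using chart_squares[OF c] dirs_sum_diags[OF de] by blast
  moreover have "c' (0, 0) \<in> c ` sq (d + e)"
    by (simp add: sq_dirs_sum[OF de] eq(1))
  ultimately obtain t where "t \<in> diags" "c ` sq (d + e) = c' ` sq t"
    using chart_squares[OF c'] by blast
  then obtain t where t: "t \<in> diags" "{c (0, 0), c d, c e, c (d + e)} = c' ` sq t"
    by (auto simp: sq_dirs_sum[OF de])
  then obtain z where z: "z \<in> sq t" "c' z = c e" by (metis imageE insertI1 insert_commute)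
  have sq: "x \<in> sq t" if "x \<in> dirs" "c' x \<in> c' ` sq t" for x
    using that dirs_blk inj_on_image_mem_iff[OF chart_inj[OF c']] sq_diags[OF t(1)] by blast
  have "\<delta> \<in> sq t" "\<epsilon> \<in> sq t"
    using sq[OF \<delta>] sq[OF \<epsilon>(1)] unfolding eq(2) \<epsilon>(2) t(2)[symmetric] by auto
  moreover have "(0, 0) \<noteq> d + e \<and> e \<noteq> (0, 0) \<and> e \<noteq> d + e \<and> e \<noteq> d"
    using de by (cases rule: perp_cases) simp_all
  then have "c (0, 0) \<noteq> c (d + e)" "c e \<noteq> c (0, 0)" "c e \<noteq> c (d + e)" "c e \<noteq> c d"
    by (simp_all only: chart_eq_iff[OF c] blk zero_blk simp_thms)
  then have "\<delta> \<noteq> \<epsilon>" "z \<noteq> \<delta>" "z \<noteq> \<epsilon>" "z \<noteq> (0, 0)"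
    using eq \<epsilon>(2) z(2) by auto
  ultimately have "z = \<delta> + \<epsilon> \<and> ip \<delta> \<epsilon> = 0"
    using z(1) \<delta> \<epsilon>(1) t(1) by (intro sq_corner[where t = t]) auto
  with \<epsilon> z show thesis using that by blast
qed

text \<open>Take any chart at \<open>c d\<close>. The two squares on the edge back to
  \<open>c (0, 0)\<close> show up in it on the two sides of the direction \<open>\<delta>\<close>,
  so it suffices to turn the chart until \<open>- d\<close> points along \<open>\<delta>\<close> and
  \<open>e\<close> along \<open>\<epsilon>\<close>.\<close>

lemma follows_exists:
  assumes c: "chart c" and d: "d \<in> dirs"
  obtains c' where "chart c'" "follows d c c'"
proof -
  obtain e where e: "e \<in> dirs" "ip d e = 0" using perp_exists[OF d] by blast
  have e': "- e \<in> dirs" "ip d (- e) = 0"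
    using e by (auto simp: dirs_def ip_def)
  have "c d \<in> V" using chart_in_V[OF c] d dirs_blk by blast
  then obtain c1 where c1: "chart c1" "c1 (0, 0) = c d" using chart_exists by blast
  have "c (0, 0) \<in> c1 ` dirs"
    using chart_centre[OF c d] chart_nbrs[OF c1(1)] c1(2) by simp
  then obtain \<delta> where \<delta>: "\<delta> \<in> dirs" "c1 \<delta> = c (0, 0)" by auto
  obtain \<epsilon> where \<epsilon>: "\<epsilon> \<in> dirs" "ip \<delta> \<epsilon> = 0" "c1 \<epsilon> = c (d + e)" "c1 (\<delta> + \<epsilon>) = c e"
    using neighbour_square[OF c c1 \<delta>(2) d e \<delta>(1)] .
  obtain \<epsilon>' where \<epsilon>': "\<epsilon>' \<in> dirs" "ip \<delta> \<epsilon>' = 0" "c1 \<epsilon>' = c (d + - e)" "c1 (\<delta> + \<epsilon>') = c (- e)"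
    using neighbour_square[OF c c1 \<delta>(2) d e' \<delta>(1)] .
  \<comment> \<open>The two squares have different far corners, so they cannot lie on the same side
    of \<open>\<delta>\<close>; this forces \<open>\<epsilon>'\<close> to be
    \<open>- \<epsilon>\<close>.\<close>
  have "d + e \<noteq> d + - e" using e by (auto simp: dirs_def)
  then have "c (d + e) \<noteq> c (d + - e)"
    by (subst chart_eq_iff[OF c]) (use dirs_sum_blk[OF d e] dirs_sum_blk[OF d e'] in auto)
  then have "\<epsilon>' \<noteq> \<epsilon>" using \<epsilon>(3) \<epsilon>'(3) by auto
  then have neg: "\<epsilon>' = - \<epsilon>"
    using dirs_opposite[OF \<epsilon>(1) \<epsilon>'(1) \<delta>(1)] \<epsilon>(2) \<epsilon>'(2) by (simp add: ip_commute)
  have "- d \<in> dirs" "ip (- d) e = 0" using d e by (auto simp: dirs_def ip_def)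
  then obtain \<sigma> where \<sigma>: "\<sigma> \<in> syms" "\<sigma> (- d) = \<delta>" "\<sigma> e = \<epsilon>"
    using syms_transitive[OF _ e(1) _ \<delta>(1) \<epsilon>(1,2)] by metis
  have s0: "\<sigma> 0 = 0" and sd: "\<sigma> d = - \<delta>"
    using syms_zero[OF \<sigma>(1)] \<sigma>(2) by (auto simp: syms_neg[OF \<sigma>(1)] zero_prod_def)
  let ?c = "restrict (c1 \<circ> \<sigma>) blk"
  have "follows d c ?c"
    unfolding follows_def
  proof (intro ballI impI)
    fix p assume p: "p \<in> blk" "p + d \<in> blk"
    have "p \<in> {(0, 0), - d, e, - e, - d + e, - d + - e}"
      using blk_shift_cases[OF d e p] .
    then have "c1 (\<sigma> p) = c (p + d)"
      using \<epsilon>(3,4) \<epsilon>'(3,4) c1(2) \<delta>(2)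
      by (elim insertE emptyE)
        (simp_all add: s0 sd \<sigma>(3) syms_diff[OF \<sigma>(1)] syms_neg[OF \<sigma>(1)] neg add.commute flip: zero_prod_def)
    then show "?c p = c (p + d)" using p by simp
  qed
  with chart_sym[OF c1(1) \<sigma>(1)] show thesis by (rule that)
qed

text \<open>The overlap contains the new centre and two perpendicular directions at it,
  \<open>- d\<close> and \<open>e\<close>.\<close>

lemma follows_unique:
  assumes "chart c1" "chart c2" "follows d c c1" "follows d c c2" "d \<in> dirs"
  shows "c1 = c2"
proof -
  obtain e where e: "e \<in> dirs" "ip d e = 0" using perp_exists[OF assms(5)] by blast
  have d': "- d \<in> dirs" "ip (- d) e = 0" using assms(5) e by (auto simp: dirs_def ip_def)
  have blk: "(0, 0) + d \<in> blk" "- d + d \<in> blk" "e + d \<in> blk" "- d \<in> blk" "e \<in> blk"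
    using assms(5) e d' dirs_blk dirs_sum_blk[OF assms(5) e] zero_blk
    by (auto simp: zero_prod_def[symmetric] add.commute)
  show ?thesis
    by (rule chart_unique'[OF assms(1,2) _ _ _ d'(1) e(1) d'(2)])
      (use blk zero_blk assms(3,4)[THEN followsD] in auto)
qed

lemma follows_sym: "follows d c c' \<Longrightarrow> follows (- d) c' c"
  by (auto simp: follows_def simp del: split_paired_All)

text \<open>Holonomy around a unit square is trivial: both charts have centre
  \<open>c (e + d)\<close> and see \<open>c e\<close> and \<open>c d\<close> in the directions
  \<open>- d\<close> and \<open>- e\<close>, since the whole square lies in the block of
  \<open>c\<close>.\<close>

lemma follows_commute:
  assumes ch: "chart c12" "chart c21"
    and f: "follows d c c1" "follows e c1 c12" "follows e c c2" "follows d c2 c21"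
    and de: "d \<in> dirs" "e \<in> dirs" "ip d e = 0"
  shows "c12 = c21"
proof -
  have blk: "d \<in> blk" "e \<in> blk" "- d \<in> blk" "- e \<in> blk" "(0, 0) \<in> blk" "d + e \<in> blk" "e - d \<in> blk" "d - e \<in> blk"
    using de by (cases rule: perp_cases; simp add: blk_iff)+
  have "c12 (0, 0) = c (e + d)" "c12 (- d) = c e" "c12 (- e) = c d"
    using followsD[OF f(2), of "(0, 0)"] followsD[OF f(2), of "- d"] followsD[OF f(2), of "- e"]
      followsD[OF f(1), of e] followsD[OF f(1), of "e - d"] followsD[OF f(1), of "(0, 0)"] blk
    by (simp_all add: zero_prod_def[symmetric] add.commute)
  moreover have "c21 (0, 0) = c (e + d)" "c21 (- d) = c e" "c21 (- e) = c d"
    using followsD[OF f(4), of "(0, 0)"] followsD[OF f(4), of "- d"] followsD[OF f(4), of "- e"]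
      followsD[OF f(3), of d] followsD[OF f(3), of "d - e"] followsD[OF f(3), of "(0, 0)"] blk
    by (simp_all add: zero_prod_def[symmetric] add.commute)
  moreover have "- d \<in> dirs" "- e \<in> dirs" "ip (- d) (- e) = 0"
    using de by (auto simp: dirs_def ip_def)
  ultimately show ?thesis by (intro chart_unique'[OF ch]) auto
qed

end


section \<open>Covering by the grid\<close>

lemma int_orbit_exists:
  assumes "bij_betw X S S" "x \<in> S"
  shows "\<exists>s :: int \<Rightarrow> 'a. s 0 = x \<and> (\<forall>n. s n \<in> S \<and> s (n + 1) = X (s n))"
proof -
  define Y where "Y = inv_into S X"
  have XS: "X y \<in> S" and YS: "Y y \<in> S" and XY: "X (Y y) = y" if "y \<in> S" for y
    using that assms(1) by (auto simp: Y_def bij_betw_def f_inv_into_f inv_into_into)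
  define s where "s n = (if 0 \<le> n then (X ^^ nat n) x else (Y ^^ nat (- n)) x)" for n
  have S: "(X ^^ k) x \<in> S" "(Y ^^ k) x \<in> S" for k
    by (induction k) (auto simp: assms(2) XS YS)
  have "s (n + 1) = X (s n)" for n
  proof (cases "0 \<le> n")
    case True
    then show ?thesis by (simp add: s_def nat_add_distrib)
  next
    case False
    then have "nat (- n) = Suc (nat (- (n + 1)))" by simp
    then have "X (s n) = (Y ^^ nat (- (n + 1))) x"
      using False S(2) XY by (simp add: s_def)
    also have "\<dots> = s (n + 1)" using False by (auto simp: s_def)
    finally show ?thesis by simp
  qed
  moreover have "s 0 = x" "s n \<in> S" for n using S by (auto simp: s_def)
  ultimately show ?thesis by blast
qed

lemma int_step_induct:
  fixes P :: "int \<Rightarrow> bool"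
  assumes "P 0" "\<And>n. P n \<Longrightarrow> P (n + 1)" "\<And>n. P n \<Longrightarrow> P (n - 1)"
  shows "P n"
  by (induction n rule: int_induct[where k = 0]) (use assms in auto)

lemma grid_induct:
  fixes P :: "int \<times> int \<Rightarrow> bool"
  assumes "P (0, 0)" "\<And>p d. P p \<Longrightarrow> d \<in> dirs \<Longrightarrow> P (p + d)"
  shows "P p"
proof -
  have "P (m, 0)" for m
  proof (induction m rule: int_step_induct)
    case 1 show ?case by (rule assms(1))
  next
    case (2 n) then show ?case using assms(2)[of "(n, 0)" "(1, 0)"] by (simp add: dirs_def)
  next
    case (3 n) then show ?case using assms(2)[of "(n, 0)" "(-1, 0)"] by (simp add: dirs_def)
  qed
  then have "P (m, n)" for m n
  proof (induction n rule: int_step_induct)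
    case 1 then show ?case by blast
  next
    case (2 n) then show ?case using assms(2)[of "(m, n)" "(0, 1)"] by (simp add: dirs_def)
  next
    case (3 n) then show ?case using assms(2)[of "(m, n)" "(0, -1)"] by (simp add: dirs_def)
  qed
  then show ?thesis by (cases p) blast
qed

section \<open>Unit steps and the covering built from them\<close>

context wheel begin

text \<open>For a chart and a direction there is only one candidate, by
  \<open>follows_unique\<close>.\<close>

definition step where
  "step d c = (SOME c'. chart c' \<and> follows d c c')"

lemma step:
  assumes "chart c" "d \<in> dirs"
  shows "chart (step d c)" "follows d c (step d c)"
  using someI_ex[of "\<lambda>c'. chart c' \<and> follows d c c'"] follows_exists[OF assms]
  unfolding step_def by blast+

lemma step_commute:
  "chart c \<Longrightarrow> d \<in> dirs \<Longrightarrow> e \<in> dirs \<Longrightarrow> ip d e = 0 \<Longrightarrow> step d (step e c) = step e (step d c)"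
  by (rule follows_commute[of _ _ e c "step e c" d "step d c"]) (simp_all add: step ip_commute)

lemma finite_charts: "finite {c. chart c}"
proof (rule finite_subset)
  show "{c. chart c} \<subseteq> (\<Pi>\<^sub>E p\<in>blk. V)"
    by (auto simp: is_chart_def PiE_def)
  show "finite (\<Pi>\<^sub>E p\<in>blk. V)"
    using finite_V by (intro finite_PiE) (auto simp: blk_def)
qed

text \<open>The chart before the step is the unique one that follows its result in direction
  \<open>- d\<close>, which gives injectivity; on a finite set this is enough.\<close>

lemma bij_step:
  assumes "d \<in> dirs"
  shows "bij_betw (step d) {c. chart c} {c. chart c}"
proof -
  have neg: "- d \<in> dirs" using assms by (auto simp: dirs_def)
  have "inj_on (step d) {c. chart c}"
  proof (rule inj_onI)
    fix c c' assume cc: "c \<in> {c. chart c}" "c' \<in> {c. chart c}" "step d c = step d c'"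
    then have "follows (- d) (step d c) c" "follows (- d) (step d c) c'"
      using step(2) assms follows_sym by (auto, metis)
    then show "c = c'" using follows_unique cc neg by blast
  qed
  moreover have "step d ` {c. chart c} \<subseteq> {c. chart c}" using step(1)[OF _ assms] by blast
  ultimately show ?thesis
    using endo_inj_surj[OF finite_charts] by (simp add: bij_betw_def)
qed

text \<open>Requiring a chart around every point is stronger than a covering map of graphs:
  \<open>f\<close> is injective on each block and respects the squares of the family.\<close>

definition covering :: "(int \<times> int \<Rightarrow> 'v) \<Rightarrow> bool" where
  "covering f \<longleftrightarrow> (\<forall>p. chart (\<lambda>d\<in>blk. f (p + d)))"

lemma coveringD: "covering f \<Longrightarrow> chart (\<lambda>d\<in>blk. f (p + d))"
  unfolding covering_def by blast

text \<open>A column of charts is obtained by iterating the upward step, and a row through each of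
  them by iterating the step to the right. The covering records the centres; the work lies in
  showing that a whole chart agrees with the centres around it.\<close>

lemma covering_exists:
  assumes "v \<in> V"
  obtains f where "covering f" "f (0, 0) = v"
proof -
  have d: "(1, 0) \<in> dirs" "(0, 1) \<in> dirs" "ip (1, 0) (0, 1) = 0" by (auto simp: dirs_def ip_def)
  let ?X = "step (1, 0)" and ?Y = "step (0, 1)"
  obtain c where c: "chart c" "c (0, 0) = v" using chart_exists assms by blast
  have "\<exists>t :: int \<Rightarrow> _. t 0 = c \<and> (\<forall>n. t n \<in> {c. chart c} \<and> t (n + 1) = ?Y (t n))"
    by (rule int_orbit_exists[OF bij_step[OF d(2)]]) (simp add: c)
  then obtain t :: "int \<Rightarrow> _" where t: "t 0 = c" "\<And>n. t n \<in> {c. chart c}" "\<And>n. t (n + 1) = ?Y (t n)"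
    by metis
  have "\<exists>s :: int \<Rightarrow> _. s 0 = t n \<and> (\<forall>m. s m \<in> {c. chart c} \<and> s (m + 1) = ?X (s m))" for n
    by (rule int_orbit_exists[OF bij_step[OF d(1)] t(2)[of n]])
  then obtain s :: "int \<Rightarrow> int \<Rightarrow> _" where s: "\<And>n. s n 0 = t n" "\<And>n m. s n m \<in> {c. chart c}"
      "\<And>n m. s n (m + 1) = ?X (s n m)"
    by metis
  \<comment> \<open>Each row is chosen on its own, and only the charts in column 0 are known to be
    related by upward steps. Commuting carries this relation along the rows.\<close>
  have Y: "s (n + 1) m = ?Y (s n m)" for n m :: int
  proof (induction m rule: int_step_induct)
    case 1 show ?case using s t by simp
  next
    case (2 m)
    then show ?case using s(2)[of n m] by (simp add: s(3) step_commute[OF _ d])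
  next
    case (3 m)
    \<comment> \<open>Going left, the equation is first proved after one step to the right, and that
      step is then cancelled by injectivity.\<close>
    have "?X (s (n + 1) (m - 1)) = s (n + 1) m"
      using s(3)[of "n + 1" "m - 1"] by simp
    also have "\<dots> = ?Y (?X (s n (m - 1)))"
      using 3 s(3)[of n "m - 1"] by simp
    also have "\<dots> = ?X (?Y (s n (m - 1)))"
      using s(2)[of n "m - 1"] by (simp add: step_commute[OF _ d])
    finally show ?case
      using bij_step[OF d(1)] s(2) step(1) d(2) unfolding bij_betw_def inj_on_def by blast
  qed
  define f where "f p = s (snd p) (fst p) (0, 0)" for p
  have X: "s n (m + 1) q = s n m (q + (1, 0))" if "q \<in> blk" "q + (1, 0) \<in> blk" for n m q
    using step(2)[OF _ d(1), of "s n m"] s(2)[of n m] that by (simp add: s(3) followsD)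
  have Y: "s (n + 1) m q = s n m (q + (0, 1))" if "q \<in> blk" "q + (0, 1) \<in> blk" for n m q
    using step(2)[OF _ d(2), of "s n m"] s(2)[of n m] that by (simp add: Y followsD)
  \<comment> \<open>A value of a chart is turned into the central value of a nearby chart, first by
    a horizontal and then by a vertical move; a corner of the block takes both.\<close>
  have horiz: "s n m (a, b) = s n (m + a) (0, b)" if ab: "\<bar>a\<bar> \<le> 1" "\<bar>b\<bar> \<le> 1" for n m a b
  proof -
    consider "a = 1" | "a = 0" | "a = -1" using ab(1) by linarith
    then show ?thesis
      using X[of "(0, b)" n m] X[of "(-1, b)" n "m - 1"] ab(2)
      by cases (simp_all add: blk_iff)
  qed
  have vert: "s n m (0, b) = s (n + b) m (0, 0)" if b: "\<bar>b\<bar> \<le> 1" for n m b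
  proof -
    consider "b = 1" | "b = 0" | "b = -1" using b by linarith
    then show ?thesis
      using Y[of "(0, 0)" n m] Y[of "(0, -1)" "n - 1" m]
      by cases (simp_all add: blk_iff)
  qed
  have "s (snd p) (fst p) q = f (p + q)" if "q \<in> blk" for p q
    using that horiz[of "fst q" "snd q" "snd p" "fst p"] vert[of "snd q" "snd p" "fst p + fst q"]
    by (simp add: f_def blk_iff)
  moreover have "s n m \<in> extensional blk" for n m
    using s(2)[of n m] unfolding is_chart_def by blast
  ultimately have "(\<lambda>q\<in>blk. f (p + q)) = s (snd p) (fst p)" for p
    by (intro extensionalityI[of _ blk]) simp_all
  then have "covering f" unfolding covering_def using s(2) by simp
  moreover have "f (0, 0) = v" using c t s by (simp add: f_def)
  ultimately show thesis by (rule that)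
qed

lemma covering_inj:
  assumes "covering f" "p \<in> blk" "q \<in> blk"
  shows "f (x + p) = f (x + q) \<longleftrightarrow> p = q"
  using chart_eq_iff[OF coveringD[OF assms(1)] assms(2,3), of x] assms(2,3) by simp

lemma covering_nbrs: "covering f \<Longrightarrow> N (f p) = (\<lambda>d. f (p + d)) ` dirs"
proof -
  assume "covering f"
  from chart_nbrs[OF coveringD[OF this, of p]] have "N (f p) = (\<lambda>d\<in>blk. f (p + d)) ` dirs"
    using zero_blk by (simp add: zero_prod_def[symmetric])
  also have "\<dots> = (\<lambda>d. f (p + d)) ` dirs"
    by (rule image_cong) (use dirs_blk in auto)
  finally show ?thesis .
qed

lemma covering_in_V: "covering f \<Longrightarrow> f p \<in> V"
  using chart_in_V[OF coveringD, of f "(0, 0)" p] zero_blk by (simp add: zero_prod_def[symmetric])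

lemma covering_affine:
  assumes f: "covering f" and s: "\<sigma> \<in> syms"
  shows "covering (\<lambda>p. f (\<sigma> p + a))"
  unfolding covering_def
proof
  fix p
  have "(\<lambda>d\<in>blk. f (\<sigma> (p + d) + a)) = restrict ((\<lambda>d\<in>blk. f (\<sigma> p + a + d)) \<circ> \<sigma>) blk"
    by (rule restrict_ext) (simp add: syms_blk[OF s] syms_add[OF s] algebra_simps)
  with chart_sym[OF coveringD[OF f] s] show "chart (\<lambda>d\<in>blk. f (\<sigma> (p + d) + a))" by simp
qed

text \<open>Agreement spreads from block to adjacent block, because the old block contains the new
  centre and two perpendicular directions at it.\<close>

lemma covering_unique:
  assumes f: "covering f" and g: "covering g"
    and eq: "\<And>d. d \<in> blk \<Longrightarrow> f d = g d"
  shows "f = g"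
proof
  fix p
  have "\<forall>d\<in>blk. f (p + d) = g (p + d)"
  proof (induction p rule: grid_induct)
    case 1 then show ?case using eq by (simp add: zero_prod_def[symmetric])
  next
    case (2 p d)
    obtain e where e: "e \<in> dirs" "ip d e = 0" using perp_exists[OF 2(2)] by blast
    have d': "- d \<in> dirs" "ip (- d) e = 0" using 2(2) e by (auto simp: dirs_def ip_def)
    have blk: "d \<in> blk" "- d \<in> blk" "e \<in> blk" "d + e \<in> blk" "(0, 0) \<in> blk"
      using 2(2) e d' dirs_blk dirs_sum_blk[OF 2(2) e] zero_blk by auto
    have "f (p + d) = g (p + d)" "f (p + 0) = g (p + 0)" "f (p + (d + e)) = g (p + (d + e))"
      using 2(1) blk by (blast, metis zero_prod_def, blast)
    then have "(\<lambda>x\<in>blk. f (p + d + x)) = (\<lambda>x\<in>blk. g (p + d + x))"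
      using blk by (intro chart_unique'[OF coveringD[OF f] coveringD[OF g] _ _ _ d'(1) e(1) d'(2)])
        (simp_all add: zero_prod_def[symmetric] add.assoc)
    then show ?case by (metis restrict_apply')
  qed
  from bspec[OF this zero_blk] show "f p = g p" by (simp add: zero_prod_def[symmetric])
qed

text \<open>This is transitivity on fibres. The charts of \<open>f\<close> at \<open>p\<close> and
  \<open>q\<close> have the same centre and so differ by some \<open>\<sigma>\<close>; the coverings
  obtained from \<open>f\<close> by moving \<open>p\<close> and \<open>q\<close> to the origin then
  agree on one block, up to that \<open>\<sigma>\<close>.\<close>

lemma covering_deck:
  assumes f: "covering f" and eq: "f p = f q"
  obtains \<sigma> where "\<sigma> \<in> syms" "\<And>x. f (\<sigma> (x - p) + q) = f x"
proof -
  obtain \<sigma> where \<sigma>: "\<sigma> \<in> syms" "\<And>d. d \<in> blk \<Longrightarrow> (\<lambda>d\<in>blk. f (p + d)) d = (\<lambda>d\<in>blk. f (q + d)) (\<sigma> d)"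
    using chart_unique[OF coveringD[OF f, of q] coveringD[OF f, of p]] eq zero_blk
    by (auto simp: zero_prod_def[symmetric])
  have "(\<lambda>x. f (\<sigma> x + q)) = (\<lambda>x. f (x + p))"
  proof (rule covering_unique)
    show "covering (\<lambda>x. f (\<sigma> x + q))" by (rule covering_affine[OF f \<sigma>(1)])
    show "covering (\<lambda>x. f (x + p))" using covering_affine[OF f id_in_syms, of p] by simp
  qed (use \<sigma> syms_blk in \<open>auto simp: add.commute\<close>)
  from fun_cong[OF this] have "f (\<sigma> (x - p) + q) = f x" for x by (metis diff_add_cancel)
  with \<sigma>(1) show thesis by (rule that)
qed

end


section \<open>Graphs with the wheel property\<close>

lemma dist_to_plane: "dist (to_plane p) (to_plane q) = 1 \<longleftrightarrow> q - p \<in> dirs"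
proof -
  obtain a b where d: "q - p = (a, b)" by fastforce
  then have "a = fst q - fst p" "b = snd q - snd p" by (auto simp: prod_eq_iff)
  then have "dist (to_plane p) (to_plane q) = sqrt (real_of_int (a\<^sup>2 + b\<^sup>2))"
    by (simp add: to_plane_def dist_Pair_Pair dist_real_def power2_commute)
  then have "dist (to_plane p) (to_plane q) = 1 \<longleftrightarrow> a\<^sup>2 + b\<^sup>2 = 1"
    by (simp only: real_sqrt_eq_1_iff of_int_eq_1_iff)
  also have "\<dots> \<longleftrightarrow> (a, b) \<in> dirs"
  proof
    assume sum: "a\<^sup>2 + b\<^sup>2 = 1"
    then have "a\<^sup>2 \<le> 1\<^sup>2" "b\<^sup>2 \<le> 1\<^sup>2" using zero_le_power2[of a] zero_le_power2[of b] unfolding one_power2 by linarith+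
    then have "\<bar>a\<bar> \<le> 1" "\<bar>b\<bar> \<le> 1" by (simp_all add: abs_square_le_1)
    then have "a \<in> {-1, 0, 1}" "b \<in> {-1, 0, 1}" by auto
    then show "(a, b) \<in> dirs" using sum by (elim insertE emptyE) (simp_all add: dirs_def)
  qed (auto simp: dirs_def)
  finally show ?thesis using d by simp
qed

lemma grid_edges: "edges grid = {{p, p + d} |p d. d \<in> dirs}"
proof -
  have "edges grid = {{p, q} |p q. q - p \<in> dirs}"
    by (simp add: grid_def dist_to_plane)
  also have "\<dots> = {{p, p + d} |p d. d \<in> dirs}"
    by (auto, metis add_diff_cancel_left' diff_add_cancel add.commute, metis add_diff_cancel_left')
  finally show ?thesis .
qed

lemma grid_simps: "verts grid = UNIV" "ends grid = id"
  by (simp_all add: grid_def)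

lemma neg_dirs: "d \<in> dirs \<Longrightarrow> - d \<in> dirs"
  by (auto simp: dirs_def)

lemma grid_edge_iff: "{p, q} \<in> edges grid \<longleftrightarrow> q - p \<in> dirs"
proof
  assume "{p, q} \<in> edges grid"
  then obtain x d where "{p, q} = {x, x + d}" "d \<in> dirs" unfolding grid_edges by blast
  then have "q - p = d \<or> q - p = - d" by (auto simp: doubleton_eq_iff)
  then show "q - p \<in> dirs" using neg_dirs \<open>d \<in> dirs\<close> by metis
next
  assume "q - p \<in> dirs"
  moreover have "{p, q} = {p, p + (q - p)}" by simp
  ultimately show "{p, q} \<in> edges grid" unfolding grid_edges by blast
qed

lemma four_cycle_through:
  assumes "four_cycle G C" "v \<in> \<Union>C"
  obtains b w d where "distinct [v, b, w, d]" "C = {{v, b}, {b, w}, {w, d}, {d, v}}"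
proof -
  obtain a b c d where abcd: "distinct [a, b, c, d]" "C = {{a, b}, {b, c}, {c, d}, {d, a}}"
    using assms(1) unfolding four_cycle_def by metis
  have "v \<in> {a, b, c, d}" using assms(2) unfolding abcd(2) by blast
  then consider "v = a" | "v = b" | "v = c" | "v = d" by blast
  then show thesis
  proof cases
    case 1 then show thesis using abcd that[of b c d] by simp
  next
    case 2 then show thesis using abcd that[of c d a] by (auto simp: insert_commute)
  next
    case 3 then show thesis using abcd that[of d a b] by (auto simp: insert_commute)
  next
    case 4 then show thesis using abcd that[of a b c] by (auto simp: insert_commute)
  qed
qed

text \<open>Opposite directions have only the origin as a common neighbour. Perpendicular ones have
  exactly one more, the far corner of their square.\<close>

lemma grid_four_cycle:
  assumes "x \<in> dirs" "y \<in> dirs" "x \<noteq> y" "w \<noteq> (0, 0)" "w - x \<in> dirs" "w - y \<in> dirs"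
  shows "ip x y = 0" "w = x + y"
proof -
  obtain a b where w: "w = (a, b)" by fastforce
  have "ip x y = 0 \<and> w = x + y"
    using assms(5,6,4,3) assms(1,2)[unfolded dirs_def]
    by (elim insertE emptyE) (auto simp: dirs_def ip_def w)
  then show "ip x y = 0" "w = x + y" by auto
qed

definition sq_cycle :: "(int \<times> int \<Rightarrow> 'v) \<Rightarrow> int \<times> int \<Rightarrow> 'v set set" where
  "sq_cycle c s = {{c (0, 0), c (fst s, 0)}, {c (fst s, 0), c s}, {c s, c (0, snd s)}, {c (0, snd s), c (0, 0)}}"

lemma Union_sq_cycle: "\<Union>(sq_cycle c s) = c ` sq s"
  by (auto simp: sq_cycle_def sq_eq)

lemma sq_cycle_dirs_sum:
  assumes "d \<in> dirs" "e \<in> dirs" "ip d e = 0"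
  shows "sq_cycle c (d + e) = {{c (0, 0), c d}, {c d, c (d + e)}, {c (d + e), c e}, {c e, c (0, 0)}}"
  using assms by (cases rule: perp_cases) (simp_all add: sq_cycle_def insert_commute)

lemma card_diags: "card diags = 4" "finite diags"
  by (simp_all add: diags_def)

lemma card_dirs: "card dirs = 4" "finite dirs"
  by (simp_all add: dirs_def)

section \<open>Charts from the wheel property\<close>

locale wheel_graph =
  fixes G :: "('v, 'v set) graph" and \<C> :: "'v set set set"
  assumes simple: "simple_graph G"
    and cycles: "C \<in> \<C> \<Longrightarrow> four_cycle G C"
    and degree: "v \<in> verts G \<Longrightarrow> card {e \<in> edges G. v \<in> e} = 4"
    and four: "v \<in> verts G \<Longrightarrow> card {C \<in> \<C>. v \<in> \<Union>C} = 4"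
    and iso: "v \<in> verts G \<Longrightarrow> \<exists>\<phi> \<psi>. graph_iso (union_of_cycles {C \<in> \<C>. v \<in> \<Union>C})
                      (induced_subgraph grid ({-1, 0, 1} \<times> {-1, 0, 1})) \<phi> \<psi> \<and> \<phi> v = (0, 0)"
begin

definition nbrs :: "'v \<Rightarrow> 'v set" where
  "nbrs v = {u. {v, u} \<in> edges G}"

lemma edge_subset: "e \<in> edges G \<Longrightarrow> e \<subseteq> verts G"
  using simple by (auto simp: simple_graph_def)

text \<open>The chart inverts the isomorphism \<open>\<phi>\<close>. The isomorphism only concerns
  the union of the cycles at \<open>v\<close>; two counts add the rest, namely that \<open>v\<close>
  has no further neighbours and that the cycles of the family at \<open>v\<close> are exactly the
  four squares.\<close>

lemma chart_exists:
  assumes v: "v \<in> verts G"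
  shows "\<exists>c. is_chart (verts G) nbrs (Union ` \<C>) c \<and> c (0, 0) = v"
proof -
  define Cv where "Cv = {C \<in> \<C>. v \<in> \<Union>C}"
  define W where "W = \<Union>(\<Union>Cv)"
  obtain \<phi> \<psi> where iso: "graph_iso (union_of_cycles Cv) (induced_subgraph grid blk) \<phi> \<psi>"
      and \<phi>v: "\<phi> v = (0, 0)"
    using iso[OF v] unfolding blk_def Cv_def by blast
  have bij: "bij_betw \<phi> W blk"
    and bij_e: "bij_betw \<psi> (\<Union>Cv) {e \<in> edges grid. e \<subseteq> blk}"
    and ends: "\<And>e. e \<in> \<Union>Cv \<Longrightarrow> \<psi> e = \<phi> ` e"
    using iso unfolding graph_iso_def union_of_cycles_def induced_subgraph_def W_def graph.simps
      grid_simps Int_UNIV_left id_apply by blast+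
  define c where "c = restrict (inv_into W \<phi>) blk"
  have c\<phi>: "c (\<phi> u) = u" if "u \<in> W" for u
    using that bij_betwE[OF bij] inv_into_f_f[OF bij_betw_imp_inj_on[OF bij] that] by (simp add: c_def)
  have \<phi>c: "\<phi> (c p) = p" and cW: "c p \<in> W" if "p \<in> blk" for p
    using that bij_betw_imp_surj_on[OF bij] by (simp_all add: c_def f_inv_into_f inv_into_into)
  have vW: "v \<in> W"
  proof -
    have "Cv \<noteq> {}" using four[OF v] unfolding Cv_def[symmetric] by auto
    then show ?thesis unfolding W_def Cv_def by auto
  qed
  have cv: "c (0, 0) = v" using c\<phi>[OF vW] \<phi>v by simp
  have sub: "\<Union>Cv \<subseteq> edges G"
    using cycles unfolding Cv_def four_cycle_def by blast
  have WV: "W \<subseteq> verts G" unfolding W_def using sub edge_subset by blast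
  have inj: "inj_on c blk" by (rule inj_on_inverseI) (rule \<phi>c)
  have adj: "{c p, c q} \<in> edges G" if "p \<in> blk" "q \<in> blk" "q - p \<in> dirs" for p q
  proof -
    have "{p, q} \<in> \<psi> ` \<Union>Cv"
      using that bij_e by (simp add: bij_betw_def grid_edge_iff)
    then obtain e where e: "e \<in> \<Union>Cv" "\<phi> ` e = {p, q}" using ends by blast
    have "c ` \<phi> ` e = e"
      using e(1) c\<phi> unfolding W_def by (force simp: image_image)
    then show ?thesis using e sub by auto
  qed
  have adj': "\<phi> y - \<phi> x \<in> dirs" if "{x, y} \<in> \<Union>Cv" for x y
  proof -
    have "\<psi> {x, y} \<in> edges grid"
      using bij_betwE[OF bij_e] that by blast
    then have "{\<phi> x, \<phi> y} \<in> edges grid"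
      using ends[OF that] by simp
    then show ?thesis by (simp add: grid_edge_iff)
  qed
  have c0: "(0, 0) \<in> blk" by (simp add: blk_iff)
  have nbrs: "nbrs (c (0, 0)) = c ` dirs"
  proof -
    \<comment> \<open>The four edges from \<open>v\<close> to the images of the directions already
      exhaust its degree.\<close>
    have "card ((\<lambda>d. {v, c d}) ` dirs) = 4"
    proof (subst card_image)
      have "c d \<noteq> v" if "d \<in> dirs" for d
        using inj_onD[OF inj, of d "(0, 0)"] that dirs_blk c0 cv by (auto simp: dirs_def)
      then show "inj_on (\<lambda>d. {v, c d}) dirs"
        using inj dirs_blk by (intro inj_onI) (metis doubleton_eq_iff inj_onD subsetD)
    qed (rule card_dirs)
    moreover have "(\<lambda>d. {v, c d}) ` dirs \<subseteq> {e \<in> edges G. v \<in> e}"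
      using adj[OF c0] dirs_blk cv by (force simp: zero_prod_def[symmetric])
    ultimately have eq: "(\<lambda>d. {v, c d}) ` dirs = {e \<in> edges G. v \<in> e}"
      using degree[OF v] by (intro card_subset_eq) (auto intro: card_ge_0_finite)
    have "u \<in> c ` dirs" if "{v, u} \<in> edges G" for u
    proof -
      have "{v, u} \<in> (\<lambda>d. {v, c d}) ` dirs" unfolding eq using that by simp
      then show ?thesis using cv by (auto simp: doubleton_eq_iff)
    qed
    moreover have "{v, c d} \<in> edges G" if "d \<in> dirs" for d
      using eq that by blast
    ultimately show ?thesis unfolding nbrs_def cv by blast
  qed
  \<comment> \<open>Under \<open>\<phi>\<close> a cycle through \<open>v\<close> becomes a 4-cycle
    of the grid through the origin, hence a unit square.\<close>
  have "C \<in> sq_cycle c ` diags" if CC: "C \<in> Cv" for C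
  proof -
    have fc: "four_cycle G C" "v \<in> \<Union>C" using cycles CC unfolding Cv_def by auto
    obtain b w d where C: "distinct [v, b, w, d]" "C = {{v, b}, {b, w}, {w, d}, {d, v}}"
      by (rule four_cycle_through[OF fc])
    have E: "{v, b} \<in> \<Union>Cv" "{b, w} \<in> \<Union>Cv" "{d, w} \<in> \<Union>Cv" "{v, d} \<in> \<Union>Cv"
    proof -
      have "{v, b} \<in> C" "{b, w} \<in> C" "{d, w} \<in> C" "{v, d} \<in> C"
        unfolding C(2) by (simp_all add: insert_commute)
      then show "{v, b} \<in> \<Union>Cv" "{b, w} \<in> \<Union>Cv" "{d, w} \<in> \<Union>Cv" "{v, d} \<in> \<Union>Cv"
        using CC by blast+
    qed
    then have W: "b \<in> W" "w \<in> W" "d \<in> W" unfolding W_def by blast+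
    have "\<phi> b \<noteq> \<phi> d" "\<phi> w \<noteq> (0, 0)"
      using c\<phi> W vW C(1) \<phi>v by (metis distinct_length_2_or_more)+
    moreover have "\<phi> b \<in> dirs" "\<phi> d \<in> dirs"
      using adj'[OF E(1)] adj'[OF E(4)] \<phi>v by (simp_all add: zero_prod_def[symmetric])
    moreover note adj'[OF E(2)] adj'[OF E(3)]
    ultimately have bd: "\<phi> b \<in> dirs" "\<phi> d \<in> dirs" "ip (\<phi> b) (\<phi> d) = 0" "\<phi> w = \<phi> b + \<phi> d"
      using grid_four_cycle by blast+
    have "sq_cycle c (\<phi> b + \<phi> d) = C"
      unfolding sq_cycle_dirs_sum[OF bd(1-3)] unfolding bd(4)[symmetric] by (simp add: c\<phi> W cv C(2))
    then show ?thesis using dirs_sum_diags[OF bd(1-3)] by blast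
  qed
  then have "Cv \<subseteq> sq_cycle c ` diags" by blast
  \<comment> \<open>There are at most four square cycles and exactly four cycles of the family at
    \<open>v\<close>, so the inclusion is an equality.\<close>
  moreover have "card (sq_cycle c ` diags) \<le> card Cv"
    using card_image_le[OF card_diags(2), of "sq_cycle c"] four[OF v] by (simp add: card_diags Cv_def)
  ultimately have "Cv = sq_cycle c ` diags"
    by (intro card_seteq) (simp_all add: card_diags)
  then have "Union ` Cv = (\<lambda>s. c ` sq s) ` diags" by (simp add: image_image Union_sq_cycle)
  moreover have "Union ` Cv = {S \<in> Union ` \<C>. v \<in> S}" unfolding Cv_def by blast
  ultimately have "{S \<in> Union ` \<C>. c (0, 0) \<in> S} = (\<lambda>s. c ` sq s) ` diags" using cv by simp
  moreover have "c (0, 0) \<in> nbrs (c d)" if "d \<in> dirs" for d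
  proof -
    have "d \<in> blk" "(0, 0) - d \<in> dirs"
      using that dirs_blk neg_dirs[OF that] by (auto simp: zero_prod_def[symmetric])
    then show ?thesis using adj[OF _ c0] unfolding nbrs_def by blast
  qed
  moreover have "c (d + e) \<in> nbrs (c d)" if "d \<in> dirs" "e \<in> dirs" "ip d e = 0" for d e
  proof -
    have "d \<in> blk" "d + e - d \<in> dirs" using that dirs_blk by auto
    then show ?thesis using adj[OF _ dirs_sum_blk[OF that]] unfolding nbrs_def by blast
  qed
  moreover have "c \<in> extensional blk" by (simp add: c_def)
  moreover have "c ` blk \<subseteq> verts G" using cW WV by blast
  ultimately have "is_chart (verts G) nbrs (Union ` \<C>) c"
    unfolding is_chart_def using inj nbrs by (intro conjI ballI impI) (assumption | blast)+
  then show ?thesis using cv by blast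
qed

lemma wheel: "wheel (verts G) nbrs (Union ` \<C>)" if "finite_graph G"
  using that chart_exists by unfold_locales (auto simp: finite_graph_def)

end

text \<open>The affine form is part of the definition, so the automorphisms of the grid need not be
  classified; it is enough that affine maps with linear part in \<open>syms\<close> are among
  them.\<close>

definition deck :: "(int \<times> int \<Rightarrow> 'v) \<Rightarrow> (int \<times> int \<Rightarrow> int \<times> int) set" where
  "deck f = {\<gamma>. (\<exists>\<sigma>\<in>syms. \<exists>a. \<gamma> = (\<lambda>x. \<sigma> x + a)) \<and> (\<forall>x. f (\<gamma> x) = f x)}"

lemma deckI: "\<sigma> \<in> syms \<Longrightarrow> (\<And>x. f (\<sigma> x + a) = f x) \<Longrightarrow> (\<lambda>x. \<sigma> x + a) \<in> deck f"
  unfolding deck_def by blast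

lemma deckE:
  assumes "\<gamma> \<in> deck f"
  obtains \<sigma> a where "\<sigma> \<in> syms" "\<gamma> = (\<lambda>x. \<sigma> x + a)"
  using assms unfolding deck_def by blast

lemma deck_invariant: "\<gamma> \<in> deck f \<Longrightarrow> f (\<gamma> x) = f x"
  unfolding deck_def by blast

lemma affine_edges:
  assumes "\<sigma> \<in> syms" "D \<in> edges grid"
  shows "(\<lambda>x. \<sigma> x + a) ` D \<in> edges grid"
proof -
  obtain p d where D: "D = {p, p + d}" "d \<in> dirs" using assms(2) unfolding grid_edges by blast
  have "(\<sigma> (p + d) + a) - (\<sigma> p + a) \<in> dirs"
    using D(2) assms(1) by (simp add: syms_add syms_dirs)
  then show ?thesis unfolding D(1) by (simp add: grid_edge_iff)
qed

lemma affine_in_grid_Aut: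
  assumes "\<sigma> \<in> syms"
  shows "(\<lambda>x. \<sigma> x + a) \<in> carrier grid_Aut"
proof -
  obtain \<tau> where \<tau>: "\<tau> \<in> syms" "\<And>p. \<sigma> (\<tau> p) = p" "\<And>p. \<tau> (\<sigma> p) = p"
    using syms_inverse[OF assms] by metis
  let ?g = "\<lambda>x. \<sigma> x + a" and ?h = "\<lambda>x. \<tau> x + \<tau> (- a)"
  have hg: "?h (?g x) = x" and gh: "?g (?h x) = x" for x
    using \<tau> assms by (simp_all add: syms_add syms_neg syms_diff)
  have "?g ` D \<in> edges grid \<longleftrightarrow> D \<in> edges grid" for D
  proof
    assume "?g ` D \<in> edges grid"
    from affine_edges[OF \<tau>(1) this, of "\<tau> (- a)"] show "D \<in> edges grid"
      unfolding image_image hg by simp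
  qed (rule affine_edges[OF assms])
  moreover have "bij ?g" by (rule o_bij[of ?h]) (auto simp: fun_eq_iff hg gh)
  ultimately show ?thesis by (simp add: grid_Aut_def Bij_def)
qed

section \<open>The graph as the quotient by the deck group\<close>

context wheel_graph begin

text \<open>The image of a covering is closed under taking neighbours, so it is everything in a
  connected graph.\<close>

lemma covering_surj:
  assumes "connected_graph G" "finite_graph G"
  obtains f where "wheel.covering (verts G) nbrs (Union ` \<C>) f" "range f = verts G"
proof -
  interpret wheel "verts G" nbrs "Union ` \<C>" by (rule wheel) fact
  obtain v where v: "v \<in> verts G" using assms(1) by (auto simp: connected_graph_def)
  obtain f where f: "covering f" "f (0, 0) = v" by (rule covering_exists[OF v])
  have "u \<in> range f" if "u \<in> verts G" for u
  proof -
    have "(v, u) \<in> {(x, y). \<exists>e\<in>edges G. ends G e = {x, y}}\<^sup>*"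
      using assms(1) v that unfolding connected_graph_def by blast
    then show ?thesis
    proof (induction rule: rtrancl_induct)
      case base show ?case using f(2) by auto
    next
      case (step x y)
      then have "y \<in> nbrs x"
        using simple by (auto simp: nbrs_def simple_graph_def)
      moreover obtain p where "x = f p" using step by auto
      ultimately show ?case using covering_nbrs[OF f(1)] by auto
    qed
  qed
  then have "range f = verts G" using covering_in_V[OF f(1)] by blast
  with f(1) show thesis by (rule that)
qed

text \<open>A vertex goes to its fibre and an edge to the set of grid edges above it. Fibres are
  orbits by transitivity. For edges, a deck transformation that matches one end also matches the
  other, because \<open>f\<close> is injective on the block around the matched end.\<close>

lemma isomorphic_quotient:
  assumes fin: "finite_graph G"
    and f: "wheel.covering (verts G) nbrs (Union ` \<C>) f" and surj: "range f = verts G"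
  shows "isomorphic G (grid_quotient (deck f))"
proof -
  interpret wheel "verts G" nbrs "Union ` \<C>" by (rule wheel) fact
  let ?Q = "grid_quotient (deck f)"
  define \<phi> where "\<phi> v = {p. f p = v}" for v
  define \<psi> where "\<psi> e = {D \<in> edges grid. f ` D = e}" for e
  have trans: "\<exists>\<gamma>\<in>deck f. \<gamma> p = q" if eq: "f p = f q" for p q
  proof -
    obtain \<sigma> where \<sigma>: "\<sigma> \<in> syms" "\<And>x. f (\<sigma> (x - p) + q) = f x"
      using covering_deck[OF f eq] by blast
    have "(\<lambda>x. \<sigma> x + (q - \<sigma> p)) \<in> deck f"
      using \<sigma> by (intro deckI) (simp_all add: syms_diff algebra_simps)
    then show ?thesis by (intro bexI) simp_all
  qed
  have orbit: "{\<gamma> x |\<gamma>. \<gamma> \<in> deck f} = \<phi> (f x)" for x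
  proof (intro equalityI subsetI)
    fix y assume "y \<in> {\<gamma> x |\<gamma>. \<gamma> \<in> deck f}"
    then obtain \<gamma> where "\<gamma> \<in> deck f" "y = \<gamma> x" by blast
    then show "y \<in> \<phi> (f x)" by (simp add: \<phi>_def deck_invariant)
  next
    fix y assume "y \<in> \<phi> (f x)"
    then have "f x = f y" by (simp add: \<phi>_def)
    from trans[OF this] show "y \<in> {\<gamma> x |\<gamma>. \<gamma> \<in> deck f}" by blast
  qed
  have edge_orbit: "{\<gamma> ` D |\<gamma>. \<gamma> \<in> deck f} = \<psi> (f ` D)" if D: "D \<in> edges grid" for D
  proof (intro equalityI subsetI)
    fix D' assume "D' \<in> {\<gamma> ` D |\<gamma>. \<gamma> \<in> deck f}"
    then obtain \<gamma> where \<gamma>: "\<gamma> \<in> deck f" "D' = \<gamma> ` D" by blast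
    have "D' \<in> edges grid"
      using \<gamma>(1) unfolding \<gamma>(2) by (rule deckE) (simp add: affine_edges D)
    then show "D' \<in> \<psi> (f ` D)"
      using deck_invariant[OF \<gamma>(1)] by (simp add: \<psi>_def \<gamma>(2) image_image)
  next
    fix D' assume "D' \<in> \<psi> (f ` D)"
    then have D': "D' \<in> edges grid" "f ` D' = f ` D" by (simp_all add: \<psi>_def)
    obtain p d where pd: "D = {p, p + d}" "d \<in> dirs" using D unfolding grid_edges by blast
    obtain p' where p': "p' \<in> D'" "f p = f p'" using D'(2) pd by (metis imageE imageI insertI1)
    obtain d' where d': "D' = {p', p' + d'}" "d' \<in> dirs"
    proof -
      obtain x y where xy: "D' = {x, x + y}" "y \<in> dirs" using D'(1) unfolding grid_edges by blast
      show thesis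
      proof (cases "p' = x")
        case True then show thesis using that xy by blast
      next
        case False
        then have "D' = {p', p' + - y}" using p' xy by auto
        then show thesis using that neg_dirs xy by blast
      qed
    qed
    obtain \<gamma> where \<gamma>: "\<gamma> \<in> deck f" "\<gamma> p = p'" using trans p'(2) by blast
    obtain \<sigma> a where \<sigma>: "\<sigma> \<in> syms" "\<gamma> = (\<lambda>x. \<sigma> x + a)" using deckE[OF \<gamma>(1)] .
    have \<gamma>d: "\<gamma> (p + d) = p' + \<sigma> d" using \<gamma>(2) \<sigma> by (simp add: syms_add algebra_simps)
    \<comment> \<open>The ends of a grid edge have different images, so once \<open>p\<close> and
      \<open>p'\<close> lie over the same vertex the other two ends must as well.\<close>
    have "d \<in> blk" "d \<noteq> (0, 0)" using pd(2) dirs_blk by (blast, auto simp: dirs_def)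
    then have "f (p + (0, 0)) \<noteq> f (p + d)" using covering_inj[OF f zero_blk] by blast
    then have "f p \<noteq> f (p + d)" by (simp add: zero_prod_def[symmetric])
    then have "f (p + d) = f (p' + d')"
      using D'(2) p'(2) unfolding pd d' by (auto simp: doubleton_eq_iff)
    then have "f (p' + \<sigma> d) = f (p' + d')"
      using deck_invariant[OF \<gamma>(1), of "p + d"] \<gamma>d by simp
    then have "\<sigma> d = d'"
      using covering_inj[OF f] syms_dirs[OF \<sigma>(1) pd(2)] d'(2) dirs_blk by blast
    then have "D' = \<gamma> ` D" using pd d' \<gamma>(2) \<gamma>d by simp
    then show "D' \<in> {\<gamma> ` D |\<gamma>. \<gamma> \<in> deck f}" using \<gamma>(1) by blast
  qed
  have verts_Q: "verts ?Q = \<phi> ` verts G"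
    unfolding grid_quotient_def orbits_def orbit_def Let_def by (auto simp: orbit grid_simps surj[symmetric])
  have edges_G: "edges G = (`) f ` edges grid"
  proof (intro equalityI subsetI)
    fix e assume e: "e \<in> edges G"
    then have "card e = 2" "e \<subseteq> verts G" using simple by (auto simp: simple_graph_def)
    then obtain x y where xy: "e = {x, y}" by (auto simp: card_2_iff)
    then obtain p where p: "x = f p" using \<open>e \<subseteq> verts G\<close> surj by blast
    have "y \<in> nbrs (f p)" using e xy p by (simp add: nbrs_def)
    then obtain d where "d \<in> dirs" "y = f (p + d)" using covering_nbrs[OF f] by blast
    then show "e \<in> (`) f ` edges grid"
      unfolding xy p by (intro image_eqI[of _ _ "{p, p + d}"]) (simp_all add: grid_edge_iff)
  next
    fix e assume "e \<in> (`) f ` edges grid"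
    then obtain p d where pd: "e = f ` {p, p + d}" "d \<in> dirs" unfolding grid_edges by blast
    have "f (p + d) \<in> nbrs (f p)" using covering_nbrs[OF f] pd(2) by blast
    then show "e \<in> edges G" by (simp add: nbrs_def pd(1))
  qed
  have edges_Q: "edges ?Q = \<psi> ` edges G"
  proof -
    have "edges ?Q = (\<lambda>D. {\<gamma> ` D |\<gamma>. \<gamma> \<in> deck f}) ` edges grid"
      by (simp add: grid_quotient_def orbits_def orbit_def Let_def image_def) blast
    also have "\<dots> = (\<lambda>D. \<psi> (f ` D)) ` edges grid"
      using edge_orbit by (rule image_cong[OF refl])
    finally show ?thesis unfolding edges_G image_image .
  qed
  have "inj_on \<phi> (verts G)"
  proof (rule inj_onI)
    fix u v assume "u \<in> verts G" and eq: "\<phi> u = \<phi> v"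
    then obtain p where "p \<in> \<phi> u" unfolding surj[symmetric] \<phi>_def by blast
    then show "u = v" using eq unfolding \<phi>_def by blast
  qed
  moreover have "inj_on \<psi> (edges G)"
  proof (rule inj_onI)
    fix e e' assume "e \<in> edges G" and eq: "\<psi> e = \<psi> e'"
    then obtain D where "D \<in> \<psi> e" unfolding edges_G \<psi>_def by blast
    then show "e = e'" using eq unfolding \<psi>_def by blast
  qed
  moreover have "ends ?Q (\<psi> e) = \<phi> ` ends G e" if "e \<in> edges G" for e
  proof -
    have "ends ?Q (\<psi> e) = (\<lambda>x. {\<gamma> x |\<gamma>. \<gamma> \<in> deck f}) ` \<Union>(\<psi> e)"
      by (simp add: grid_quotient_def Let_def orbit_def)
    also have "\<dots> = \<phi> ` f ` \<Union>(\<psi> e)" by (simp only: orbit image_image)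
    also have "f ` \<Union>(\<psi> e) = e"
      using that unfolding edges_G \<psi>_def by blast
    finally show ?thesis using simple by (simp add: simple_graph_def)
  qed
  ultimately have "graph_iso G ?Q \<phi> \<psi>"
    unfolding graph_iso_def bij_betw_def verts_Q edges_Q by blast
  then show ?thesis unfolding isomorphic_def by blast
qed

end


section \<open>Subgroups of the automorphism group of the grid\<close>

lemma grid_Aut_mult: "f \<in> carrier grid_Aut \<Longrightarrow> g \<in> carrier grid_Aut \<Longrightarrow> f \<otimes>\<^bsub>grid_Aut\<^esub> g = f \<circ> g"
  by (simp add: grid_Aut_def BijGroup_def compose_def restrict_def comp_def)

lemma grid_Aut_one: "\<one>\<^bsub>grid_Aut\<^esub> = id"
  by (simp add: grid_Aut_def BijGroup_def restrict_def id_def)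

lemma grid_subgroup_comp:
  assumes "subgroup H grid_Aut" "f \<in> H" "g \<in> H"
  shows "f \<circ> g \<in> H"
  using subgroup.m_closed[OF assms] subgroup.mem_carrier[OF assms(1)] assms(2,3)
  by (simp add: grid_Aut_mult)

lemma grid_subgroup_inverse:
  assumes H: "subgroup H grid_Aut" and f: "f \<in> H"
  obtains g where "g \<in> H" "\<And>x. f (g x) = x" "\<And>x. g (f x) = x"
proof -
  let ?g = "inv\<^bsub>grid_Aut\<^esub> f"
  have g: "?g \<in> H" by (rule subgroup.m_inv_closed[OF H f])
  have c: "f \<in> carrier grid_Aut" "?g \<in> carrier grid_Aut"
    using subgroup.mem_carrier[OF H] f g by blast+
  have "f \<circ> ?g = id" "?g \<circ> f = id"
    using group.r_inv[OF group_grid_Aut c(1)] group.l_inv[OF group_grid_Aut c(1)] c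
    by (simp_all add: grid_Aut_mult grid_Aut_one)
  with g show thesis using that by (metis comp_apply id_apply)
qed

lemma grid_subgroup_id: "subgroup H grid_Aut \<Longrightarrow> id \<in> H"
  using subgroup.one_closed by (fastforce simp: grid_Aut_one)

definition scl :: "int \<Rightarrow> int \<times> int \<Rightarrow> int \<times> int" where
  "scl k w = (k * fst w, k * snd w)"

lemma ip_scl: "ip (scl k w) u = k * ip w u"
  by (simp add: ip_def scl_def algebra_simps)

lemma ip_minus: "ip (- x) u = - ip x u" and ip_add: "ip (x + y) u = ip x u + ip y u" and ip_diff: "ip (x - y) u = ip x u - ip y u"
  by (simp_all add: ip_def algebra_simps)

lemma translation_comp: "translation v \<circ> translation w = translation (v + w)"
  by (simp add: translation_def fun_eq_iff algebra_simps)

lemma translation_diff_mem: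
  assumes "subgroup H grid_Aut" "translation v \<in> H" "translation w \<in> H"
  shows "translation (v - w) \<in> H"
proof -
  obtain g where g: "g \<in> H" "\<And>x. translation w (g x) = x"
    using grid_subgroup_inverse[OF assms(1,3)] by metis
  have "g = translation (- w)"
  proof
    fix x show "g x = translation (- w) x" using g(2)[of x] by (simp add: translation_def algebra_simps)
  qed
  then show ?thesis
    using grid_subgroup_comp[OF assms(1,2) g(1)] by (simp add: translation_comp)
qed

lemma translation_scl_mem:
  assumes H: "subgroup H grid_Aut" and v: "translation v \<in> H"
  shows "translation (scl m v) \<in> H"
proof (induction m rule: int_step_induct)
  case 1
  have "translation (scl 0 v) = id" by (simp add: translation_def scl_def fun_eq_iff zero_prod_def[symmetric])
  then show ?case using grid_subgroup_id[OF H] by metis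
next
  case (2 m)
  have "scl (m + 1) v = scl m v + v" by (simp add: scl_def algebra_simps prod_eq_iff)
  then show ?case using grid_subgroup_comp[OF H 2 v] by (simp add: translation_comp)
next
  case (3 m)
  have "scl (m - 1) v = scl m v - v" by (simp add: scl_def algebra_simps prod_eq_iff)
  then show ?case using translation_diff_mem[OF H 3 v] by simp
qed

section \<open>Two generators from the displacement homomorphism\<close>

lemma int_subgroup_generator:
  fixes I :: "int set"
  assumes diff: "\<And>x y. x \<in> I \<Longrightarrow> y \<in> I \<Longrightarrow> x - y \<in> I" and k: "k \<in> I" "k \<noteq> 0"
  obtains d where "d > 0" "d \<in> I" "\<And>x. x \<in> I \<Longrightarrow> d dvd x"
proof -
  have zero: "0 \<in> I" using diff[OF k(1) k(1)] by simp
  have neg: "- x \<in> I" if "x \<in> I" for x using diff[OF zero that] by simp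
  have mult: "m * x \<in> I" if "x \<in> I" for m x
  proof (induction m rule: int_step_induct)
    case 1 show ?case using zero by simp
  next
    case (2 m) show ?case using diff[OF 2 neg[OF that]] by (simp add: algebra_simps)
  next
    case (3 m) show ?case using diff[OF 3 that] by (simp add: algebra_simps)
  qed
  define d where "d = (LEAST n. n > 0 \<and> int n \<in> I)"
  have "\<exists>n>0. int n \<in> I"
    by (rule exI[of _ "nat \<bar>k\<bar>"]) (use k neg[OF k(1)] in \<open>auto simp: abs_if\<close>)
  from LeastI_ex[OF this] have d: "d > 0" "int d \<in> I" unfolding d_def by auto
  have "int d dvd x" if x: "x \<in> I" for x
  proof (rule ccontr)
    assume nd: "\<not> int d dvd x"
    define r where "r = x mod int d"
    have "r = x - (x div int d) * int d" by (simp add: r_def minus_div_mult_eq_mod)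
    then have "r \<in> I" using diff[OF x mult[OF d(2)]] by simp
    moreover have "r > 0" "r < int d"
      using nd d(1) by (auto simp: r_def dvd_eq_mod_eq_0 order.not_eq_order_implies_strict)
    moreover from this have "nat r < d" by (simp add: nat_less_iff)
    ultimately show False
      using not_less_Least[of "nat r" "\<lambda>n. n > 0 \<and> int n \<in> I"] unfolding d_def[symmetric] by auto
  qed
  then show thesis using that[of "int d"] d by simp
qed

text \<open>Displacement in direction \<open>u\<close> is a homomorphism to the integers whose kernel consists of
  translations, so a generator of its image and a generator of its kernel generate the group.\<close>
lemma two_generators:
  assumes H: "subgroup H grid_Aut"
    and perp: "\<And>w. ip w u = 0 \<Longrightarrow> \<exists>m. w = scl m u'" "ip u' u = 0" "u' \<noteq> (0, 0)" "ip u u \<noteq> 0"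
    and disp: "\<And>\<gamma> p. \<gamma> \<in> H \<Longrightarrow> ip (\<gamma> p - p) u = h \<gamma>"
    and ker: "\<And>\<gamma>. \<gamma> \<in> H \<Longrightarrow> h \<gamma> = 0 \<Longrightarrow> \<exists>v. \<gamma> = translation v"
    and recur: "\<And>w. \<exists>k l. k \<noteq> l \<and> (\<exists>\<gamma>\<in>H. \<gamma> (scl k w) = scl l w)"
  obtains d w where "d \<noteq> 0" "w \<noteq> (0, 0)" "ip w u = 0" "d \<in> h ` H" "\<And>\<gamma>. \<gamma> \<in> H \<Longrightarrow> d dvd h \<gamma>"
    "\<And>g. g \<in> H \<Longrightarrow> h g = d \<Longrightarrow> H = generate grid_Aut {g, translation w}"
proof -
  have h_comp: "h (\<gamma> \<circ> \<delta>) = h \<gamma> + h \<delta>" if "\<gamma> \<in> H" "\<delta> \<in> H" for \<gamma> \<delta>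
  proof -
    have "h (\<gamma> \<circ> \<delta>) = ip ((\<gamma> \<circ> \<delta>) 0 - 0) u"
      using disp[OF grid_subgroup_comp[OF H that]] by metis
    also have "\<dots> = ip (\<gamma> (\<delta> 0) - \<delta> 0) u + ip (\<delta> 0 - 0) u" by (simp add: ip_diff)
    finally show ?thesis by (simp only: disp that)
  qed
  have h_inv: "\<exists>\<delta>\<in>H. h \<delta> = - h \<gamma> \<and> (\<forall>x. \<gamma> (\<delta> x) = x) \<and> (\<forall>x. \<delta> (\<gamma> x) = x)" if \<gamma>: "\<gamma> \<in> H" for \<gamma>
  proof -
    obtain \<delta> where \<delta>: "\<delta> \<in> H" "\<And>x. \<gamma> (\<delta> x) = x" "\<And>x. \<delta> (\<gamma> x) = x"
      using grid_subgroup_inverse[OF H \<gamma>] by metis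
    have "h \<delta> = - h \<gamma>"
      using disp[OF \<gamma>, of "\<delta> 0"] disp[OF \<delta>(1), of 0] by (simp add: \<delta>(2) ip_minus)
    then show ?thesis using \<delta> by blast
  qed
  have disp_scl: "h \<gamma> = (l - k) * ip w u" if "\<gamma> \<in> H" "\<gamma> (scl k w) = scl l w" for \<gamma> k l w
    using disp[OF that(1), of "scl k w"] that(2) by (simp add: ip_diff ip_scl algebra_simps)
  obtain d where d: "d > 0" "d \<in> h ` H" "\<And>x. x \<in> h ` H \<Longrightarrow> d dvd x"
  proof -
    \<comment> \<open>Recurrence along \<open>u\<close> itself yields the displacement
      \<open>(l - k) * ip u u\<close>, which is nonzero.\<close>
    obtain k l \<gamma> where "k \<noteq> l" "\<gamma> \<in> H" "\<gamma> (scl k u) = scl l u" using recur by blast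
    then have "h \<gamma> \<in> h ` H" "h \<gamma> \<noteq> 0" using disp_scl[of \<gamma> k u l] perp(4) by (blast, simp)
    moreover have "x - y \<in> h ` H" if xy: "x \<in> h ` H" "y \<in> h ` H" for x y
    proof -
      obtain \<gamma> \<delta> where \<gamma>\<delta>: "\<gamma> \<in> H" "x = h \<gamma>" "\<delta> \<in> H" "y = h \<delta>" using xy by blast
      obtain \<delta>' where \<delta>': "\<delta>' \<in> H" "h \<delta>' = - h \<delta>" using h_inv[OF \<gamma>\<delta>(3)] by blast
      have "\<gamma> \<circ> \<delta>' \<in> H" "h (\<gamma> \<circ> \<delta>') = x - y"
        using grid_subgroup_comp[OF H \<gamma>\<delta>(1) \<delta>'(1)] h_comp[OF \<gamma>\<delta>(1) \<delta>'(1)]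
        by (simp_all add: \<gamma>\<delta> \<delta>')
      then show ?thesis by (intro image_eqI[of _ h "\<gamma> \<circ> \<delta>'"]) simp_all
    qed
    ultimately show thesis using int_subgroup_generator[of "h ` H" "h \<gamma>"] that by blast
  qed
  \<comment> \<open>Counting multiples of \<open>u'\<close> identifies the kernel of
    \<open>h\<close> with a subgroup of the integers. Recurrence along \<open>u'\<close> shows that
    it is not trivial.\<close>
  define J where "J = {m. translation (scl m u') \<in> H}"
  obtain j where j: "j > 0" "j \<in> J" "\<And>x. x \<in> J \<Longrightarrow> j dvd x"
  proof -
    obtain k l \<gamma> where kl: "k \<noteq> l" "\<gamma> \<in> H" "\<gamma> (scl k u') = scl l u'" using recur by blast
    then have "h \<gamma> = 0" using disp_scl[of \<gamma> k u' l] perp(2) by simp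
    then obtain v where v: "\<gamma> = translation v" using ker kl by blast
    then have "v = scl (l - k) u'"
      using kl(3) by (auto simp: translation_def scl_def algebra_simps prod_eq_iff)
    then have "l - k \<in> J" using kl(2) v by (simp add: J_def)
    moreover have "x - y \<in> J" if "x \<in> J" "y \<in> J" for x y
    proof -
      have "scl (x - y) u' = scl x u' - scl y u'" by (simp add: scl_def algebra_simps prod_eq_iff)
      then show ?thesis using translation_diff_mem[OF H] that by (simp add: J_def)
    qed
    ultimately show thesis using int_subgroup_generator kl(1) that by (metis right_minus_eq)
  qed
  define w where "w = scl j u'"
  have w: "translation w \<in> H" using j(2) by (simp add: J_def w_def)
  have "w \<noteq> (0, 0)" using j(1) perp(3) by (cases u') (auto simp: w_def scl_def)
  moreover have "ip w u = 0" using perp(2) by (simp add: w_def ip_scl)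
  moreover have "H = generate grid_Aut {g, translation w}" if g: "g \<in> H" "h g = d" for g
  proof
    let ?K = "generate grid_Aut {g, translation w}"
    have gens: "{g, translation w} \<subseteq> carrier grid_Aut"
      using g(1) w subgroup.subset[OF H] by blast
    have K: "subgroup ?K grid_Aut" by (rule group.generate_is_subgroup[OF group_grid_Aut gens])
    have gK: "g \<in> ?K" "translation w \<in> ?K" by (auto intro: generate.incl)
    show "?K \<subseteq> H"
      using g(1) w by (intro group.generate_subgroup_incl[OF group_grid_Aut _ H]) blast
    obtain g' where g': "g' \<in> ?K" "\<And>x. g (g' x) = x" "\<And>x. g' (g x) = x"
      using grid_subgroup_inverse[OF K gK(1)] by metis
    have g'H: "g' \<in> H" using g'(1) \<open>?K \<subseteq> H\<close> by blast
    have "id = g \<circ> g'" using g'(2) by (simp add: fun_eq_iff)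
    then have hg': "h g' = - d"
      using h_comp[OF g(1) g'H] h_comp[OF grid_subgroup_id[OF H] grid_subgroup_id[OF H]] g(2) by simp
    \<comment> \<open>Composing with \<open>g\<close> or its inverse changes the displacement by
      \<open>d\<close>, which reduces everything to the kernel; there each element is a translation
      by a multiple of \<open>w\<close>.\<close>
    have "\<forall>\<gamma>\<in>H. h \<gamma> = n * d \<longrightarrow> \<gamma> \<in> ?K" for n
    proof (induction n rule: int_step_induct)
      case 1
      show ?case
      proof (intro ballI impI)
        fix \<gamma> assume \<gamma>: "\<gamma> \<in> H" "h \<gamma> = 0 * d"
        from \<gamma>(2) have "h \<gamma> = 0" by simp
        then obtain v where v: "\<gamma> = translation v" using ker[OF \<gamma>(1)] by blast
        then have "ip v u = 0" using disp[OF \<gamma>(1), of 0] \<gamma>(2) by (simp add: translation_def)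
        then obtain m where m: "v = scl m u'" using perp(1) by blast
        then have "m \<in> J" using \<gamma>(1) v by (simp add: J_def)
        then obtain q where "m = j * q" using j(3) by blast
        then have "v = scl q w" by (simp add: m w_def scl_def algebra_simps)
        then show "\<gamma> \<in> ?K" using translation_scl_mem[OF K gK(2)] v by simp
      qed
    next
      case (2 n)
      show ?case
      proof (intro ballI impI)
        fix \<gamma> assume \<gamma>: "\<gamma> \<in> H" "h \<gamma> = (n + 1) * d"
        have "\<gamma> \<circ> g' \<in> H" "h (\<gamma> \<circ> g') = n * d"
          using grid_subgroup_comp[OF H \<gamma>(1) g'H] h_comp[OF \<gamma>(1) g'H] hg' \<gamma>(2) by (auto simp: algebra_simps)
        then have "\<gamma> \<circ> g' \<circ> g \<in> ?K" using 2 grid_subgroup_comp[OF K _ gK(1)] by blast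
        moreover have "\<gamma> \<circ> g' \<circ> g = \<gamma>" using g'(3) by (simp add: fun_eq_iff)
        ultimately show "\<gamma> \<in> ?K" by simp
      qed
    next
      case (3 n)
      show ?case
      proof (intro ballI impI)
        fix \<gamma> assume \<gamma>: "\<gamma> \<in> H" "h \<gamma> = (n - 1) * d"
        have "\<gamma> \<circ> g \<in> H" "h (\<gamma> \<circ> g) = n * d"
          using grid_subgroup_comp[OF H \<gamma>(1) g(1)] h_comp[OF \<gamma>(1) g(1)] g(2) \<gamma>(2) by (auto simp: algebra_simps)
        then have "\<gamma> \<circ> g \<circ> g' \<in> ?K" using 3 grid_subgroup_comp[OF K _ g'(1)] by blast
        moreover have "\<gamma> \<circ> g \<circ> g' = \<gamma>" using g'(2) by (simp add: fun_eq_iff)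
        ultimately show "\<gamma> \<in> ?K" by simp
      qed
    qed
    then show "H \<subseteq> ?K" using d(3) by (metis dvdE imageI mult.commute subsetI)
  qed
  moreover have "d \<noteq> 0" "d \<in> h ` H" "\<And>\<gamma>. \<gamma> \<in> H \<Longrightarrow> d dvd h \<gamma>" using d by auto
  ultimately show thesis using that by blast
qed

lemma subgroup_deck: "subgroup (deck f) grid_Aut"
proof (rule group.subgroupI[OF group_grid_Aut])
  show sub: "deck f \<subseteq> carrier grid_Aut"
  proof
    fix \<gamma> assume "\<gamma> \<in> deck f"
    then show "\<gamma> \<in> carrier grid_Aut" by (rule deckE) (simp add: affine_in_grid_Aut)
  qed
  have "(\<lambda>x. id x + 0) \<in> deck f" by (rule deckI[OF id_in_syms]) simp
  then show "deck f \<noteq> {}" by blast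
  fix \<gamma> assume \<gamma>: "\<gamma> \<in> deck f"
  obtain \<sigma> a where \<sigma>: "\<sigma> \<in> syms" "\<gamma> = (\<lambda>x. \<sigma> x + a)" using deckE[OF \<gamma>] .
  show "inv\<^bsub>grid_Aut\<^esub> \<gamma> \<in> deck f"
  proof -
    obtain \<tau> where \<tau>: "\<tau> \<in> syms" "\<And>p. \<sigma> (\<tau> p) = p" "\<And>p. \<tau> (\<sigma> p) = p"
      using syms_inverse[OF \<sigma>(1)] by metis
    let ?h = "\<lambda>x. \<tau> x + \<tau> (- a)"
    have "\<gamma> (?h x) = x" and h: "?h (\<gamma> x) = x" for x
      using \<tau> \<sigma> by (simp_all add: syms_add syms_neg syms_diff)
    then have hd: "?h \<in> deck f"
      by (intro deckI[OF \<tau>(1)]) (metis deck_invariant[OF \<gamma>])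
    have "?h \<otimes>\<^bsub>grid_Aut\<^esub> \<gamma> = \<one>\<^bsub>grid_Aut\<^esub>"
      using h sub \<gamma> hd by (simp add: grid_Aut_mult grid_Aut_one subset_iff fun_eq_iff)
    then have "inv\<^bsub>grid_Aut\<^esub> \<gamma> = ?h"
      using group.inv_equality[OF group_grid_Aut] sub \<gamma> hd by blast
    then show ?thesis using hd by simp
  qed
  fix \<delta> assume \<delta>: "\<delta> \<in> deck f"
  obtain \<tau> b where \<tau>: "\<tau> \<in> syms" "\<delta> = (\<lambda>x. \<tau> x + b)" using deckE[OF \<delta>] .
  have eq: "\<gamma> \<circ> \<delta> = (\<lambda>x. (\<sigma> \<circ> \<tau>) x + (\<sigma> b + a))"
    by (simp add: \<sigma> \<tau> syms_add fun_eq_iff algebra_simps)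
  have "\<gamma> \<circ> \<delta> \<in> deck f"
    unfolding eq
  proof (rule deckI[OF syms_comp[OF \<sigma>(1) \<tau>(1)]])
    fix x show "f ((\<sigma> \<circ> \<tau>) x + (\<sigma> b + a)) = f x"
      using deck_invariant[OF \<gamma>, of "\<delta> x"] deck_invariant[OF \<delta>, of x] fun_cong[OF eq, of x] by simp
  qed
  then show "\<gamma> \<otimes>\<^bsub>grid_Aut\<^esub> \<delta> \<in> deck f" using sub \<gamma> \<delta> by (simp add: grid_Aut_mult subset_iff)
qed


section \<open>Classification of the deck group\<close>

definition det_sym :: "(int \<times> int \<Rightarrow> int \<times> int) \<Rightarrow> int" where
  "det_sym \<sigma> = fst (\<sigma> (1, 0)) * snd (\<sigma> (0, 1)) - snd (\<sigma> (1, 0)) * fst (\<sigma> (0, 1))"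

lemma det_sym_cases: "\<sigma> \<in> syms \<Longrightarrow> det_sym \<sigma> = 1 \<or> det_sym \<sigma> = -1"
proof (erule symsE)
  fix d e assume "\<sigma> = lin d e" "d \<in> dirs" "e \<in> dirs" "ip d e = 0"
  from this(2-4,1) show ?thesis
    by (cases rule: perp_cases) (simp_all add: det_sym_def)
qed

lemma det_sym_comp:
  assumes "\<sigma> \<in> syms" "\<tau> \<in> syms"
  shows "det_sym (\<sigma> \<circ> \<tau>) = det_sym \<sigma> * det_sym \<tau>"
proof -
  obtain a b where "\<sigma> = lin a b" using assms(1) by (rule symsE)
  moreover obtain c d where "\<tau> = lin c d" using assms(2) by (rule symsE)
  ultimately show ?thesis
    by (simp add: lin_comp det_sym_def) (simp add: lin_def algebra_simps)
qed

text \<open>A nontrivial rotation of the grid has a vertex, edge or square centre as its centre.\<close>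
lemma rotation_small_displacement:
  assumes "\<sigma> \<in> syms" "det_sym \<sigma> = 1" "\<sigma> \<noteq> id"
  obtains p where "\<sigma> p + a - p \<in> blk"
  using assms(1)
proof (rule symsE)
  fix d e assume de: "\<sigma> = lin d e" "d \<in> dirs" "e \<in> dirs" "ip d e = 0"
  obtain a1 a2 where a: "a = (a1, a2)" by fastforce
  have "(d = (0, 1) \<and> e = (-1, 0)) \<or> (d = (-1, 0) \<and> e = (0, -1)) \<or> (d = (0, -1) \<and> e = (1, 0))"
    using de(2-4,1) assms(2,3) lin_id by (cases rule: perp_cases) (simp_all add: det_sym_def)
  then show thesis
  proof (elim disjE conjE)
    assume "d = (0, 1)" "e = (-1, 0)"
    \<comment> \<open>The centre of this quarter turn solves \<open>2 * x = a1 - a2\<close> and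
      \<open>y = x + a2\<close>. Rounding \<open>x\<close> down leaves a displacement of 0 or 1 in
      the first coordinate and none in the second. The other two witnesses are rounded centres as
      well.\<close>
    then have "\<sigma> ((a1 - a2) div 2, (a1 - a2) div 2 + a2) + a - ((a1 - a2) div 2, (a1 - a2) div 2 + a2) \<in> blk"
      by (simp add: de(1) lin_def a blk_iff; presburger)
    then show thesis by (rule that)
  next
    assume "d = (-1, 0)" "e = (0, -1)"
    then have "\<sigma> (a1 div 2, a2 div 2) + a - (a1 div 2, a2 div 2) \<in> blk"
      by (simp add: de(1) lin_def a blk_iff; presburger)
    then show thesis by (rule that)
  next
    assume "d = (0, -1)" "e = (1, 0)"
    then have "\<sigma> ((a1 + a2) div 2, (a1 + a2) div 2 - a1) + a - ((a1 + a2) div 2, (a1 + a2) div 2 - a1) \<in> blk"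
      by (simp add: de(1) lin_def a blk_iff; presburger)
    then show thesis by (rule that)
  qed
qed

text \<open>Here \<open>u\<close> is the direction of the axis and \<open>u'\<close> a primitive
  vector across it, so that \<open>u'\<close> generates all integer vectors perpendicular to
  \<open>u\<close>. The displacement of the affine map along \<open>u\<close> is
  \<open>ip a u\<close>. If it vanishes, the map is a mirror reflection and some lattice point on or
  next to the mirror moves within its block; otherwise the map is a glide reflection.\<close>

lemma reflection_axis:
  assumes "\<sigma> \<in> syms" "det_sym \<sigma> = -1"
  obtains u u' where "to_plane u \<in> {(0, 1), (1, 0), (1, 1), (1, -1)}"
    "u' \<noteq> (0, 0)" "ip u' u = 0" "ip u u \<noteq> 0"
    "\<And>w. ip w u = 0 \<Longrightarrow> \<exists>m. w = scl m u'" "\<And>x. ip (\<sigma> x) u = ip x u"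
    "\<And>a. ip a u = 0 \<Longrightarrow> \<exists>p. \<sigma> p + a - p \<in> blk"
    "\<And>a. ip a u \<noteq> 0 \<Longrightarrow> \<exists>F. glide_reflection_along (to_plane u) F \<and> (\<forall>p. F (to_plane p) = to_plane (\<sigma> p + a))"
  using assms(1)
proof (rule symsE)
  fix d e assume de: "\<sigma> = lin d e" "d \<in> dirs" "e \<in> dirs" "ip d e = 0"
  have "(d = (1, 0) \<and> e = (0, -1)) \<or> (d = (-1, 0) \<and> e = (0, 1)) \<or>
      (d = (0, 1) \<and> e = (1, 0)) \<or> (d = (0, -1) \<and> e = (-1, 0))"
    using de(2-4,1) assms(2) by (cases rule: perp_cases) (simp_all add: det_sym_def)
  then show thesis
  proof (elim disjE conjE)
    assume *: "d = (1, 0)" "e = (0, -1)"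
    have s: "\<sigma> p = (fst p, - snd p)" for p by (simp add: de(1) * lin_def)
    show thesis
    proof (rule that[of "(1, 0)" "(0, 1)"])
      fix w assume "ip w (1, 0) = 0"
      then show "\<exists>m. w = scl m (0, 1)"
        by (intro exI[of _ "snd w"]) (simp add: ip_def scl_def prod_eq_iff)
    next
      fix a assume a: "ip a (1, 0) = 0"
      \<comment> \<open>The mirror has height \<open>snd a / 2\<close>; a lattice point at the
        rounded height moves by 0 or 1.\<close>
      have "\<sigma> (0, snd a div 2) + a - (0, snd a div 2) \<in> blk"
        using a by (simp add: s ip_def blk_iff; presburger)
      then show "\<exists>p. \<sigma> p + a - p \<in> blk" ..
    next
      fix a assume a: "ip a (1, 0) \<noteq> 0"
      let ?F = "\<lambda>x. reflection_in_line (0, real_of_int (snd a) / 2) (to_plane (1, 0))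
        (x + real_of_int (fst a) *\<^sub>R to_plane (1, 0))"
      have "glide_reflection_along (to_plane (1, 0)) ?F"
        unfolding glide_reflection_along_def
        using a by (intro conjI exI[of _ "(0, real_of_int (snd a) / 2)"] exI[of _ "real_of_int (fst a)"])
          (auto simp: to_plane_def ip_def zero_prod_def)
      moreover have "?F (to_plane p) = to_plane (\<sigma> p + a)" for p
        by (simp add: reflection_in_line_def to_plane_def s field_simps)
      ultimately show "\<exists>F. glide_reflection_along (to_plane (1, 0)) F \<and> (\<forall>p. F (to_plane p) = to_plane (\<sigma> p + a))"
        by (intro exI[of _ ?F]) simp
    qed (auto simp: to_plane_def ip_def s)
  next
    assume *: "d = (-1, 0)" "e = (0, 1)"
    have s: "\<sigma> p = (- fst p, snd p)" for p by (simp add: de(1) * lin_def)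
    show thesis
    proof (rule that[of "(0, 1)" "(1, 0)"])
      fix w assume "ip w (0, 1) = 0"
      then show "\<exists>m. w = scl m (1, 0)"
        by (intro exI[of _ "fst w"]) (simp add: ip_def scl_def prod_eq_iff)
    next
      fix a assume a: "ip a (0, 1) = 0"
      have "\<sigma> (fst a div 2, 0) + a - (fst a div 2, 0) \<in> blk"
        using a by (simp add: s ip_def blk_iff; presburger)
      then show "\<exists>p. \<sigma> p + a - p \<in> blk" ..
    next
      fix a assume a: "ip a (0, 1) \<noteq> 0"
      let ?F = "\<lambda>x. reflection_in_line (real_of_int (fst a) / 2, 0) (to_plane (0, 1))
        (x + real_of_int (snd a) *\<^sub>R to_plane (0, 1))"
      have "glide_reflection_along (to_plane (0, 1)) ?F"
        unfolding glide_reflection_along_def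
        using a by (intro conjI exI[of _ "(real_of_int (fst a) / 2, 0)"] exI[of _ "real_of_int (snd a)"])
          (auto simp: to_plane_def ip_def zero_prod_def)
      moreover have "?F (to_plane p) = to_plane (\<sigma> p + a)" for p
        by (simp add: reflection_in_line_def to_plane_def s field_simps)
      ultimately show "\<exists>F. glide_reflection_along (to_plane (0, 1)) F \<and> (\<forall>p. F (to_plane p) = to_plane (\<sigma> p + a))"
        by (intro exI[of _ ?F]) simp
    qed (auto simp: to_plane_def ip_def s)
  next
    assume *: "d = (0, 1)" "e = (1, 0)"
    have s: "\<sigma> p = (snd p, fst p)" for p by (simp add: de(1) * lin_def)
    show thesis
    proof (rule that[of "(1, 1)" "(1, -1)"])
      fix w assume "ip w (1, 1) = 0"
      then show "\<exists>m. w = scl m (1, -1)"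
        by (intro exI[of _ "fst w"]) (simp add: ip_def scl_def prod_eq_iff)
    next
      fix a assume a: "ip a (1, 1) = 0"
      \<comment> \<open>Diagonal mirrors need no rounding: this lattice point lies on the mirror and
        is fixed.\<close>
      have "\<sigma> (fst a, 0) + a - (fst a, 0) \<in> blk"
        using a by (simp add: s ip_def blk_iff)
      then show "\<exists>p. \<sigma> p + a - p \<in> blk" ..
    next
      fix a assume a: "ip a (1, 1) \<noteq> 0"
      \<comment> \<open>The part of \<open>a\<close> along the axis is \<open>?c\<close> times the
        direction. Half of the part across it shifts the axis, and \<open>?q\<close> is the point
        where the shifted axis meets the horizontal coordinate axis. Both may be
        half-integral.\<close>
      let ?c = "(real_of_int (fst a) + real_of_int (snd a)) / 2"
      let ?q = "((real_of_int (fst a) - real_of_int (snd a)) / 2, 0)"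
      let ?F = "\<lambda>x. reflection_in_line ?q (to_plane (1, 1)) (x + ?c *\<^sub>R to_plane (1, 1))"
      have "?c \<noteq> 0" using a by (simp add: ip_def flip: of_int_add)
      then have "glide_reflection_along (to_plane (1, 1)) ?F"
        unfolding glide_reflection_along_def
        by (intro conjI exI[of _ ?q] exI[of _ ?c]) (simp_all add: to_plane_def zero_prod_def)
      moreover have "?F (to_plane p) = to_plane (\<sigma> p + a)" for p
        by (simp add: reflection_in_line_def to_plane_def s field_simps)
      ultimately show "\<exists>F. glide_reflection_along (to_plane (1, 1)) F \<and> (\<forall>p. F (to_plane p) = to_plane (\<sigma> p + a))"
        by (intro exI[of _ ?F]) simp
    qed (auto simp: to_plane_def ip_def s)
  next
    assume *: "d = (0, -1)" "e = (-1, 0)"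
    have s: "\<sigma> p = (- snd p, - fst p)" for p by (simp add: de(1) * lin_def)
    show thesis
    proof (rule that[of "(1, -1)" "(1, 1)"])
      fix w assume "ip w (1, -1) = 0"
      then show "\<exists>m. w = scl m (1, 1)"
        by (intro exI[of _ "fst w"]) (simp add: ip_def scl_def prod_eq_iff)
    next
      fix a assume a: "ip a (1, -1) = 0"
      have "\<sigma> (fst a, 0) + a - (fst a, 0) \<in> blk"
        using a by (simp add: s ip_def blk_iff)
      then show "\<exists>p. \<sigma> p + a - p \<in> blk" ..
    next
      fix a assume a: "ip a (1, -1) \<noteq> 0"
      let ?c = "(real_of_int (fst a) - real_of_int (snd a)) / 2"
      let ?q = "((real_of_int (fst a) + real_of_int (snd a)) / 2, 0)"
      let ?F = "\<lambda>x. reflection_in_line ?q (to_plane (1, -1)) (x + ?c *\<^sub>R to_plane (1, -1))"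
      have "?c \<noteq> 0" using a by (simp add: ip_def flip: of_int_diff)
      then have "glide_reflection_along (to_plane (1, -1)) ?F"
        unfolding glide_reflection_along_def
        by (intro conjI exI[of _ ?q] exI[of _ ?c]) (simp_all add: to_plane_def zero_prod_def)
      moreover have "?F (to_plane p) = to_plane (\<sigma> p + a)" for p
        by (simp add: reflection_in_line_def to_plane_def s field_simps)
      ultimately show "\<exists>F. glide_reflection_along (to_plane (1, -1)) F \<and> (\<forall>p. F (to_plane p) = to_plane (\<sigma> p + a))"
        by (intro exI[of _ ?F]) simp
    qed (auto simp: to_plane_def ip_def s)
  qed
qed

lemma inner_to_plane: "to_plane v \<bullet> to_plane w = real_of_int (ip v w)"
  by (simp add: to_plane_def ip_def)

lemma independent_to_plane:
  assumes "ip v u \<noteq> 0" "ip w u = 0" "w \<noteq> (0, 0)"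
  shows "v \<noteq> w" "independent {to_plane v, to_plane w}"
proof -
  show "v \<noteq> w" using assms by auto
  have "to_plane w \<noteq> 0" using assms(3) by (cases w) (simp add: to_plane_def zero_prod_def)
  moreover have "to_plane v \<notin> span {to_plane w}"
  proof
    assume "to_plane v \<in> span {to_plane w}"
    then obtain k where "to_plane v = k *\<^sub>R to_plane w" by (auto simp: span_singleton)
    then have "to_plane v \<bullet> to_plane u = k * (to_plane w \<bullet> to_plane u)" by simp
    then show False using assms(1,2) by (simp add: inner_to_plane)
  qed
  ultimately show "independent {to_plane v, to_plane w}"
    by (simp add: independent_insert)
qed

lemma translation_eq_affine: "translation v = (\<lambda>x. id x + v)"
  by (simp add: translation_def fun_eq_iff)

section \<open>The deck group of a covering\<close>

context wheel begin

text \<open>Injectivity of \<open>f\<close> on the block at \<open>p\<close> is used twice: it first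
  makes \<open>p\<close> a fixed point, and then each point of the block around \<open>p\<close>,
  since \<open>\<sigma>\<close> maps the block to itself.\<close>

lemma deck_small_displacement:
  assumes f: "covering f" and \<sigma>: "\<sigma> \<in> syms" and \<gamma>: "(\<lambda>x. \<sigma> x + a) \<in> deck f" and small: "\<sigma> p + a - p \<in> blk"
  shows "\<sigma> = id"
proof -
  have inv: "f (\<sigma> x + a) = f x" for x using deck_invariant[OF \<gamma>] .
  have "f (p + (\<sigma> p + a - p)) = f (p + (0, 0))"
    using inv[of p] by (simp add: zero_prod_def[symmetric])
  then have "\<sigma> p + a - p = (0, 0)" using covering_inj[OF f small zero_blk] by blast
  then have "\<sigma> p + a = p" by (simp add: zero_prod_def[symmetric])
  then have shift: "\<sigma> (p + d) + a = p + \<sigma> d" for d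
    by (simp add: syms_add[OF \<sigma>] algebra_simps)
  have fixed: "\<sigma> d = d" if "d \<in> blk" for d
  proof -
    have "f (p + \<sigma> d) = f (p + d)" using inv[of "p + d"] shift by simp
    then show ?thesis using covering_inj[OF f syms_blk[OF \<sigma> that] that] by blast
  qed
  obtain d e where "\<sigma> = lin d e" using \<sigma> by (rule symsE)
  then show ?thesis
    using fixed[of "(1, 0)"] fixed[of "(0, 1)"] by (simp add: blk_iff lin_id)
qed

text \<open>Among the multiples of \<open>w\<close> two have the same image, because
  \<open>V\<close> is finite. The deck transformation that relates them may be a glide reflection,
  which is why \<open>two_generators\<close> asks only for recurrence and not for
  translations.\<close>

lemma deck_recurrent:
  assumes f: "covering f"
  shows "\<exists>k l. k \<noteq> l \<and> (\<exists>\<gamma>\<in>deck f. \<gamma> (scl k w) = scl l w)"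
proof -
  have "finite (range (\<lambda>k. f (scl k w)))"
    using covering_in_V[OF f] by (intro finite_subset[OF _ finite_V]) blast
  then have "\<not> inj (\<lambda>k. f (scl k w))"
    using finite_imageD infinite_UNIV_int by blast
  then obtain k l where kl: "k \<noteq> l" "f (scl k w) = f (scl l w)" unfolding inj_def by blast
  obtain \<sigma> where \<sigma>: "\<sigma> \<in> syms" "\<And>x. f (\<sigma> (x - scl k w) + scl l w) = f x"
    using covering_deck[OF f kl(2)] by blast
  have "(\<lambda>x. \<sigma> x + (scl l w - \<sigma> (scl k w))) \<in> deck f"
    using \<sigma> by (intro deckI) (simp_all add: syms_diff algebra_simps)
  with kl(1) show ?thesis by (intro exI[of _ k] exI[of _ l] conjI bexI) simp_all
qed

lemma deck_classification:
  assumes f: "covering f" and iso: "isomorphic G (grid_quotient (deck f))"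
  shows "generalised_discrete_torus_graph G \<or> discrete_Klein_bottle_graph G"
proof (cases "\<forall>\<gamma>\<in>deck f. \<exists>v. \<gamma> = translation v")
  case True
  \<comment> \<open>Among translations alone no direction is distinguished; the vertical one is
    chosen, with \<open>(1, 0)\<close> across it.\<close>
  define h where "h \<gamma> = ip (\<gamma> 0) (0, 1)" for \<gamma> :: "int \<times> int \<Rightarrow> int \<times> int"
  have disp: "ip (\<gamma> p - p) (0, 1) = h \<gamma>" if "\<gamma> \<in> deck f" for \<gamma> p
    using True that by (auto simp: h_def translation_def)
  obtain d w where dw: "d \<noteq> 0" "w \<noteq> (0, 0)" "ip w (0, 1) = 0" "d \<in> h ` deck f"
      "\<And>g. g \<in> deck f \<Longrightarrow> h g = d \<Longrightarrow> deck f = generate grid_Aut {g, translation w}"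
  proof (rule two_generators[OF subgroup_deck[of f], of "(0, 1)" "(1, 0)" h])
    show "\<exists>m. w = scl m (1, 0)" if "ip w (0, 1) = 0" for w
      using that by (intro exI[of _ "fst w"]) (simp add: ip_def scl_def prod_eq_iff)
  qed (use disp True deck_recurrent[OF f] in \<open>auto simp: ip_def\<close>)
  then obtain g where g: "g \<in> deck f" "h g = d" by blast
  then obtain v where v: "g = translation v" using True by blast
  have "ip v (0, 1) \<noteq> 0" using g(2) dw(1) by (simp add: v h_def translation_def)
  note ind = independent_to_plane[OF this dw(3,2)]
  have "generalised_discrete_torus_graph G"
    unfolding generalised_discrete_torus_graph_def
    using ind iso dw(5)[OF g] v by metis
  then show ?thesis ..
next
  case False
  have rot: "\<sigma> = id" if "\<sigma> \<in> syms" "(\<lambda>x. \<sigma> x + a) \<in> deck f" "det_sym \<sigma> = 1" for \<sigma> a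
    using rotation_small_displacement[OF that(1,3), of a] deck_small_displacement[OF f that(1,2)] by blast
  from False obtain \<gamma>0 where \<gamma>0: "\<gamma>0 \<in> deck f" "\<And>v. \<gamma>0 \<noteq> translation v" by blast
  obtain \<sigma>0 a0 where \<sigma>0: "\<sigma>0 \<in> syms" "\<gamma>0 = (\<lambda>x. \<sigma>0 x + a0)" using deckE[OF \<gamma>0(1)] .
  have det0: "det_sym \<sigma>0 = -1"
    using det_sym_cases[OF \<sigma>0(1)] rot[OF \<sigma>0(1)] \<gamma>0 \<sigma>0(2) translation_eq_affine by metis
  \<comment> \<open>Two orientation-reversing elements compose to one with determinant 1, whose
    linear part is the identity. So \<open>\<sigma>0\<close> inverts both itself and every other
    reversing linear part, which leaves a single axis direction.\<close>
  have linear_part: "\<sigma> = id \<or> \<sigma> = \<sigma>0" if \<sigma>: "\<sigma> \<in> syms" "(\<lambda>x. \<sigma> x + a) \<in> deck f" for \<sigma> a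
  proof (cases "det_sym \<sigma> = 1")
    case True then show ?thesis using rot \<sigma> by blast
  next
    case False
    have comp: "\<sigma>0 \<circ> \<tau> = id" if \<tau>: "\<tau> \<in> syms" "(\<lambda>x. \<tau> x + b) \<in> deck f" "det_sym \<tau> = -1" for \<tau> b
    proof (rule rot)
      show "\<sigma>0 \<circ> \<tau> \<in> syms" by (rule syms_comp[OF \<sigma>0(1) \<tau>(1)])
      have "\<gamma>0 \<circ> (\<lambda>x. \<tau> x + b) = (\<lambda>x. (\<sigma>0 \<circ> \<tau>) x + (\<sigma>0 b + a0))"
        by (simp add: \<sigma>0 syms_add fun_eq_iff algebra_simps)
      then show "(\<lambda>x. (\<sigma>0 \<circ> \<tau>) x + (\<sigma>0 b + a0)) \<in> deck f"
        using grid_subgroup_comp[OF subgroup_deck \<gamma>0(1) \<tau>(2)] by simp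
      show "det_sym (\<sigma>0 \<circ> \<tau>) = 1" using det_sym_comp[OF \<sigma>0(1) \<tau>(1)] det0 \<tau>(3) by simp
    qed
    have "det_sym \<sigma> = -1" using det_sym_cases[OF \<sigma>(1)] False by blast
    then have "\<sigma>0 (\<sigma> x) = x" "\<sigma>0 (\<sigma>0 x) = x" for x
      using comp[OF \<sigma>] comp[OF \<sigma>0(1) _ det0] \<gamma>0(1) \<sigma>0(2) by (metis comp_apply id_apply)+
    then have "\<sigma> = \<sigma>0" using inj_syms[OF \<sigma>0(1)] by (metis ext injD)
    then show ?thesis ..
  qed
  obtain u u' where u: "to_plane u \<in> {(0, 1), (1, 0), (1, 1), (1, -1)}"
    "u' \<noteq> (0, 0)" "ip u' u = 0" "ip u u \<noteq> 0"
    "\<And>w. ip w u = 0 \<Longrightarrow> \<exists>m. w = scl m u'" "\<And>x. ip (\<sigma>0 x) u = ip x u"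
    "\<And>a. ip a u = 0 \<Longrightarrow> \<exists>p. \<sigma>0 p + a - p \<in> blk"
    "\<And>a. ip a u \<noteq> 0 \<Longrightarrow> \<exists>F. glide_reflection_along (to_plane u) F \<and> (\<forall>p. F (to_plane p) = to_plane (\<sigma>0 p + a))"
    using reflection_axis[OF \<sigma>0(1) det0] by metis
  have "\<sigma>0 \<noteq> id" using det0 by (auto simp: det_sym_def)
  then have glide: "ip a u \<noteq> 0" if "(\<lambda>x. \<sigma>0 x + a) \<in> deck f" for a
    using deck_small_displacement[OF f \<sigma>0(1) that] u(7) by blast
  define h where "h \<gamma> = ip (\<gamma> 0) u" for \<gamma> :: "int \<times> int \<Rightarrow> int \<times> int"
  have h_affine: "h (\<lambda>x. \<sigma> x + a) = ip a u" if "\<sigma> \<in> syms" for \<sigma> a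
    using syms_zero[OF that] by (simp add: h_def zero_prod_def[symmetric])
  have deck_cases: "(\<exists>v. \<gamma> = translation v) \<or> (\<exists>a. \<gamma> = (\<lambda>x. \<sigma>0 x + a))" if \<gamma>: "\<gamma> \<in> deck f" for \<gamma>
  proof -
    obtain \<sigma> a where "\<sigma> \<in> syms" "\<gamma> = (\<lambda>x. \<sigma> x + a)" using deckE[OF \<gamma>] .
    then show ?thesis using linear_part[of \<sigma> a] \<gamma> translation_eq_affine by metis
  qed
  \<comment> \<open>The displacement is the same at every point because both possible linear parts
    preserve the component along \<open>u\<close>.\<close>
  have disp: "ip (\<gamma> p - p) u = h \<gamma>" if "\<gamma> \<in> deck f" for \<gamma> p
    using deck_cases[OF that]
  proof (elim disjE exE)
    fix v assume "\<gamma> = translation v"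
    then show ?thesis by (simp add: h_def translation_def)
  next
    fix a assume "\<gamma> = (\<lambda>x. \<sigma>0 x + a)"
    then show ?thesis using h_affine[OF \<sigma>0(1), of a] u(6)[of p] by (simp add: ip_add ip_diff)
  qed
  have ker: "\<exists>v. \<gamma> = translation v" if "\<gamma> \<in> deck f" "h \<gamma> = 0" for \<gamma>
    using deck_cases[OF that(1)] that h_affine[OF \<sigma>0(1)] glide by auto
  obtain d w where dw: "d \<noteq> 0" "w \<noteq> (0, 0)" "ip w u = 0" "d \<in> h ` deck f"
      "\<And>\<gamma>. \<gamma> \<in> deck f \<Longrightarrow> d dvd h \<gamma>"
      "\<And>g. g \<in> deck f \<Longrightarrow> h g = d \<Longrightarrow> deck f = generate grid_Aut {g, translation w}"
    using two_generators[OF subgroup_deck u(5,3,2,4) disp ker deck_recurrent[OF f]] by metis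
  obtain a where a: "(\<lambda>x. \<sigma>0 x + a) \<in> deck f" "ip a u = d"
  proof -
    obtain g where g: "g \<in> deck f" "h g = d" using dw(4) by blast
    from deck_cases[OF g(1)] show thesis
    proof (elim disjE exE)
      fix v assume v: "g = translation v"
      \<comment> \<open>When the minimal displacement \<open>d\<close> comes with a translation by
        \<open>v\<close>, the glide reflection \<open>\<gamma>0\<close> has displacement
        \<open>d * n\<close>; the translation by \<open>1 - n\<close> times \<open>v\<close>
        corrects this to \<open>d\<close>.\<close>
      obtain n where n: "ip a0 u = d * n"
        using dw(5)[OF \<gamma>0(1)] h_affine[OF \<sigma>0(1), of a0] \<sigma>0(2) by (auto elim: dvdE)
      have "ip v u = d" using g(2) by (simp add: v h_def translation_def)
      then have "ip (a0 + scl (1 - n) v) u = d" by (simp add: ip_add ip_scl n algebra_simps)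
      moreover have "translation (scl (1 - n) v) \<circ> \<gamma>0 \<in> deck f"
        using translation_scl_mem[OF subgroup_deck g(1)[unfolded v]] \<gamma>0(1)
        by (rule grid_subgroup_comp[OF subgroup_deck])
      moreover have "translation (scl (1 - n) v) \<circ> \<gamma>0 = (\<lambda>x. \<sigma>0 x + (a0 + scl (1 - n) v))"
        by (simp add: \<sigma>0(2) translation_def fun_eq_iff algebra_simps)
      ultimately show thesis using that by metis
    next
      fix a assume "g = (\<lambda>x. \<sigma>0 x + a)"
      then show thesis using that g h_affine[OF \<sigma>0(1)] by metis
    qed
  qed
  let ?g = "\<lambda>x. \<sigma>0 x + a"
  obtain F where F: "glide_reflection_along (to_plane u) F" "\<And>p. F (to_plane p) = to_plane (?g p)"
    using u(8) a(2) dw(1) by metis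
  have "isomorphic G (grid_quotient (generate grid_Aut {?g, translation w}))"
    using iso dw(6)[OF a(1)] h_affine[OF \<sigma>0(1)] a(2) by simp
  moreover have "w \<noteq> 0" "to_plane w \<bullet> to_plane u = 0"
    using dw(2,3) by (simp_all add: inner_to_plane zero_prod_def)
  moreover have "?g \<in> carrier grid_Aut" by (rule affine_in_grid_Aut[OF \<sigma>0(1)])
  ultimately have "discrete_Klein_bottle_graph G"
    unfolding discrete_Klein_bottle_graph_def using F u(1)
    by (intro bexI[of _ "to_plane u"] bexI[of _ ?g] exI[of _ F] exI[of _ w] conjI allI)
  then show ?thesis ..
qed

end

theorem theorem4:
  fixes G :: "('v, 'v set) graph"
  assumes "simple_graph G"
    and "finite_graph G"
    and "connected_graph G"
    and "four_cycle_wheel_property G"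
  shows "generalised_discrete_torus_graph G \<or> discrete_Klein_bottle_graph G"
proof -
  obtain \<C> where "wheel_graph G \<C>"
    using assms(1,4) unfolding four_cycle_wheel_property_def wheel_graph_def by blast
  then interpret wheel_graph G \<C> .
  interpret wheel "verts G" nbrs "Union ` \<C>" by (rule wheel[OF assms(2)])
  obtain f where "covering f" "range f = verts G"
    by (rule covering_surj[OF assms(3,2)])
  then show ?thesis
    using deck_classification isomorphic_quotient[OF assms(2)] by blast
qed

end
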